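(* Let $n\ge 3$, let $\Sigma\subset\mathbb R^n$ be a connected embedded $C^2$ hypersurface, let $g_1,\ldots,g_n>0$ be pair-sum nonresonant weights, and let $D_t=\operatorname{diag}(t^{g_1},\ldots,t^{g_n})$ for $t>0$. Put $N=\binom n2$. The following are equivalent: (1) $D_t\Sigma$ is minimal for every $t>0$; (2) $D_{t_1}\Sigma,\ldots,D_{t_N}\Sigma$ are minimal for some $N$ distinct positive numbers $t_1,\ldots,t_N$; (3) $\Sigma$ is a connected open subset of an affine hyperplane of $\mathbb R^n$ (open relative to the hyperplane).
   Context: Weights $g_1,\ldots,g_n>0$ are pair-sum nonresonant if the $\binom n2$ sums $g_i+g_j$ ($1\le i<j\le n$) are all distinct. A $C^2$ hypersurface in $\mathbb R^n$ is minimal (Euclidean minimal) if its mean-curvature vector with respect to the Euclidean metric vanishes identically. No completeness or properness is assumed. $D_t\Sigma$ is the image of $\Sigma$ under the linear map $D_t$. *)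

theory Defs
  imports "HOL-Analysis.Analysis"
begin

definition C2_on :: "('a::euclidean_space \<Rightarrow> real) \<Rightarrow> 'a set \<Rightarrow> bool" where
  "C2_on F U \<longleftrightarrow> (\<exists>F' F''.
     (\<forall>x\<in>U. (F has_derivative blinfun_apply (F' x)) (at x)) \<and>
     (\<forall>x\<in>U. (F' has_derivative blinfun_apply (F'' x)) (at x)) \<and>
     continuous_on U (F'' :: 'a \<Rightarrow> 'a \<Rightarrow>\<^sub>L ('a \<Rightarrow>\<^sub>L real)))"

text \<open>
  Embedded hypersurfaces are taken as subsets of the ambient space that are locally regular
  level sets; nothing is assumed about closedness or completeness.
\<close>

definition C2_hypersurface :: "'a::euclidean_space set \<Rightarrow> bool" where
  "C2_hypersurface S \<longleftrightarrow> (\<forall>p\<in>S. \<exists>U F. open U \<and> p \<in> U \<and> C2_on F U \<and>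
     (\<forall>x\<in>U. frechet_derivative F (at x) \<noteq> (\<lambda>h. 0)) \<and>
     S \<inter> U = {x \<in> U. F x = 0})"

definition tangent_space :: "'a::euclidean_space set \<Rightarrow> 'a \<Rightarrow> 'a set" where
  "tangent_space S p = {v. \<exists>\<gamma>. \<gamma> 0 = p \<and> (\<forall>\<^sub>F t in nhds (0::real). \<gamma> t \<in> S) \<and>
     (\<gamma> has_vector_derivative v) (at 0)}"

text \<open>
  A unit normal field is given as a field on an open subset of the ambient space; only its
  values on the hypersurface are constrained.
\<close>

definition unit_normal_field :: "'a::euclidean_space set \<Rightarrow> 'a set \<Rightarrow> ('a \<Rightarrow> 'a) \<Rightarrow> bool" where
  "unit_normal_field S U \<nu> \<longleftrightarrow> open U \<and> \<nu> differentiable_on U \<and>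
     (\<forall>x\<in>S \<inter> U. norm (\<nu> x) = 1 \<and> (\<forall>v\<in>tangent_space S x. \<nu> x \<bullet> v = 0))"

text \<open>
  Weingarten's formula: for tangent fields \<open>X\<close>, \<open>Y\<close> the normal part of the derivative of \<open>Y\<close>
  along \<open>X\<close> is \<open>- (D\<^sub>X \<nu> \<bullet> Y) \<nu>\<close>, because \<open>\<nu> \<bullet> Y = 0\<close>.
\<close>

definition second_fundamental_form ::
    "('a::euclidean_space \<Rightarrow> 'a) \<Rightarrow> 'a \<Rightarrow> 'a \<Rightarrow> 'a \<Rightarrow> 'a" where
  "second_fundamental_form \<nu> p u v = - (frechet_derivative \<nu> (at p) u \<bullet> v) *\<^sub>R \<nu> p"

definition orthonormal_basis_of :: "'a::euclidean_space set \<Rightarrow> 'a set \<Rightarrow> bool" where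
  "orthonormal_basis_of B T \<longleftrightarrow>
     pairwise orthogonal B \<and> (\<forall>e\<in>B. norm e = 1) \<and> span B = T"

text \<open>
  The mean curvature vector is the full trace of the second fundamental form, not the average
  of the principal curvatures. The choices of \<open>\<nu>\<close> (including its sign) and of the basis do not
  matter, see \<open>has_mean_curvature_vector_ex1\<close> below.
\<close>

definition has_mean_curvature_vector :: "'a::euclidean_space set \<Rightarrow> 'a \<Rightarrow> 'a \<Rightarrow> bool" where
  "has_mean_curvature_vector S p h \<longleftrightarrow> (\<exists>U \<nu> B.
     p \<in> U \<and> unit_normal_field S U \<nu> \<and> orthonormal_basis_of B (tangent_space S p) \<and>
     h = (\<Sum>e\<in>B. second_fundamental_form \<nu> p e e))"

definition mean_curvature_vector :: "'a::euclidean_space set \<Rightarrow> 'a \<Rightarrow> 'a" where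
  "mean_curvature_vector S p = (THE h. has_mean_curvature_vector S p h)"

definition minimal_hypersurface :: "'a::euclidean_space set \<Rightarrow> bool" where
  "minimal_hypersurface S \<longleftrightarrow> C2_hypersurface S \<and> (\<forall>p\<in>S. mean_curvature_vector S p = 0)"

text \<open>The index type carries no order, so the pairs \<open>i < j\<close> become two-element sets.\<close>

definition pair_sum_nonresonant :: "('n::finite \<Rightarrow> real) \<Rightarrow> bool" where
  "pair_sum_nonresonant g \<longleftrightarrow> inj_on (\<lambda>P. \<Sum>i\<in>P. g i) {P. card P = 2}"

definition dilation :: "('n::finite \<Rightarrow> real) \<Rightarrow> real \<Rightarrow> real^'n \<Rightarrow> real^'n" where
  "dilation g t x = (\<chi> i. t powr g i * x $ i)"


subsection \<open>The mean curvature vector is well defined\<close>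

lemma C2_onE:
  fixes F :: "'a::euclidean_space \<Rightarrow> real"
  assumes "C2_on F U" "open U"
  obtains G H where
    "\<And>x. x \<in> U \<Longrightarrow> (F has_derivative (\<lambda>h. G x \<bullet> h)) (at x)"
    "\<And>x. x \<in> U \<Longrightarrow> (G has_derivative blinfun_apply (H x)) (at x)"
    "continuous_on U (H :: 'a \<Rightarrow> 'a \<Rightarrow>\<^sub>L 'a)"
proof -
  obtain F' and F'' :: "'a \<Rightarrow> 'a \<Rightarrow>\<^sub>L ('a \<Rightarrow>\<^sub>L real)" where
    F: "\<And>x. x \<in> U \<Longrightarrow> (F has_derivative blinfun_apply (F' x)) (at x)"
    "\<And>x. x \<in> U \<Longrightarrow> (F' has_derivative blinfun_apply (F'' x)) (at x)"
    "continuous_on U F''"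
    using assms unfolding C2_on_def by blast
  define R :: "('a \<Rightarrow>\<^sub>L real) \<Rightarrow> 'a" where "R = (\<lambda>l. \<Sum>b\<in>Basis. blinfun_apply l b *\<^sub>R b)"
  have R: "bounded_linear R"
    unfolding R_def by (auto intro!: bounded_linear_intros)
  have Ri: "R l \<bullet> h = blinfun_apply l h" for l h
  proof -
    have "R l \<bullet> h = (\<Sum>b\<in>Basis. (h \<bullet> b) * blinfun_apply l b)"
      unfolding R_def inner_sum_left by (simp add: inner_commute mult.commute)
    also have "\<dots> = blinfun_apply l (\<Sum>b\<in>Basis. (h \<bullet> b) *\<^sub>R b)"
      by (simp add: blinfun.sum_right blinfun.scaleR_right)
    finally show ?thesis by (simp add: euclidean_representation)
  qed
  show thesis
  proof (rule that)
    show "(F has_derivative (\<lambda>h. R (F' x) \<bullet> h)) (at x)" if "x \<in> U" for x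
      using F(1)[OF that] by (simp add: Ri)
    show "((\<lambda>x. R (F' x)) has_derivative blinfun_apply (Blinfun R o\<^sub>L F'' x)) (at x)"
      if "x \<in> U" for x
    proof -
      have "blinfun_apply (Blinfun R o\<^sub>L F'' x) = (\<lambda>h. R (blinfun_apply (F'' x) h))"
        by (rule ext) (simp add: bounded_linear_Blinfun_apply[OF R])
      then show ?thesis
        using bounded_linear.has_derivative[OF R F(2)[OF that]] by simp
    qed
    show "continuous_on U (\<lambda>x. Blinfun R o\<^sub>L F'' x)"
      using F(3) by (intro continuous_intros)
  qed
qed

lemma tangent_space_level_set:
  fixes F :: "'a::euclidean_space \<Rightarrow> real"
  assumes U: "open U" "p \<in> U"
    and F: "\<And>x. x \<in> U \<Longrightarrow> (F has_derivative (\<lambda>h. G x \<bullet> h)) (at x)"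
    and G: "continuous_on U G" "G p \<noteq> 0"
    and S: "S \<inter> U = {x \<in> U. F x = 0}" "p \<in> S"
  shows "tangent_space S p = {v. G p \<bullet> v = 0}"
proof safe
  fix v assume "v \<in> tangent_space S p"
  then obtain \<gamma> where g: "\<gamma> 0 = p" "\<forall>\<^sub>F t in nhds (0::real). \<gamma> t \<in> S"
     "(\<gamma> has_vector_derivative v) (at 0)"
    unfolding tangent_space_def by blast
  have "isCont \<gamma> 0" using g(3) has_vector_derivative_continuous by blast
  then have "(\<gamma> \<longlongrightarrow> p) (nhds 0)"
    using g(1) by (metis isCont_def tendsto_at_iff_tendsto_nhds)
  then have "\<forall>\<^sub>F t in nhds 0. \<gamma> t \<in> U"
    using U by (rule topological_tendstoD)
  then have ev: "\<forall>\<^sub>F t in nhds 0. 0 = F (\<gamma> t)"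
    using g(2) by eventually_elim (use S in auto)
  have "((\<lambda>t. F (\<gamma> t)) has_derivative (\<lambda>h. G p \<bullet> (h *\<^sub>R v))) (at 0)"
    using has_derivative_compose[of \<gamma> "\<lambda>h. h *\<^sub>R v" 0 UNIV F "\<lambda>h. G p \<bullet> h"] g(1,3) F[OF U(2)]
    by (simp add: has_vector_derivative_def)
  moreover have "((\<lambda>t. F (\<gamma> t)) has_derivative (\<lambda>h. 0)) (at 0)"
  proof (rule has_derivative_transform_eventually[OF has_derivative_const[of 0]])
    show "\<forall>\<^sub>F t in at 0. 0 = F (\<gamma> t)"
      using ev unfolding eventually_at_filter by (rule eventually_mono) simp
    show "0 = F (\<gamma> 0)" using eventually_nhds_x_imp_x[OF ev] .
  qed simp
  ultimately have "(\<lambda>h. G p \<bullet> (h *\<^sub>R v)) = (\<lambda>h. 0)"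
    by (rule has_derivative_unique)
  from fun_cong[OF this, of 1] show "G p \<bullet> v = 0" by simp
next
  fix v assume v: "G p \<bullet> v = 0"
  define c where "c = G p \<bullet> G p"
  have c: "c \<noteq> 0" using G(2) by (simp add: c_def)
  define \<Phi> where "\<Phi> = (\<lambda>x. x + ((F x - G p \<bullet> (x - p)) / c) *\<^sub>R G p)"
  define D where "D = (\<lambda>x. id_blinfun + (blinfun_scaleR_left (G p) o\<^sub>L
      (blinfun_scaleR_right (1/c) o\<^sub>L blinfun_inner_left (G x - G p))))"
  have Dapp: "blinfun_apply (D x) h = h + ((G x \<bullet> h - G p \<bullet> h) / c) *\<^sub>R G p" for x h
    by (simp add: D_def blinfun.add_left inner_diff_left inner_diff_right inner_commute)
  have der: "(\<Phi> has_derivative blinfun_apply (D x)) (at x)" if "x \<in> U" for x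
  proof -
    have "(\<Phi> has_derivative (\<lambda>h. h + ((G x \<bullet> h - G p \<bullet> h) / c) *\<^sub>R G p)) (at x)"
      unfolding \<Phi>_def using c
      by (auto intro!: derivative_eq_intros F[OF that] simp: divide_inverse)
    then show ?thesis by (simp add: Dapp[abs_def])
  qed
  have cont: "continuous_on U D"
    unfolding D_def by (intro continuous_intros G)
  have id: "id_blinfun o\<^sub>L D p = id_blinfun"
    by (rule blinfun_eqI) (simp add: Dapp)
  obtain U' V \<Psi> \<Psi>' where I: "open U'" "U' \<subseteq> U" "p \<in> U'" "open V" "\<Phi> p \<in> V"
      "homeomorphism U' V \<Phi> \<Psi>"
    "\<And>y. y \<in> V \<Longrightarrow> (\<Psi> has_derivative (\<Psi>' y)) (at y)"
    "\<And>y. y \<in> V \<Longrightarrow> \<Psi>' y = inv (blinfun_apply (D (\<Psi> y)))"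
    by (rule inverse_function_theorem[OF U(1) der cont U(2) id]) (assumption, rule that)
  have F0: "F p = 0" using S U by blast
  have Pp: "\<Phi> p = p" by (simp add: \<Phi>_def F0)
  have Psp: "\<Psi> p = p" using homeomorphism_apply1[OF I(6) I(3)] Pp by simp
  have Dp: "blinfun_apply (D p) = (\<lambda>x. x)" by (rule ext) (simp add: Dapp)
  have "\<Psi>' p = (\<lambda>x. x)"
    using I(8)[of p] I(5) Pp Psp Dp by (simp add: inv_id[unfolded id_def])
  then have dPs: "(\<Psi> has_derivative (\<lambda>x. x)) (at p)"
    using I(5,7) Pp by metis
  have gder: "((\<lambda>t. \<Psi> (p + t *\<^sub>R v)) has_vector_derivative v) (at 0)"
  proof -
    have "((\<lambda>t. p + t *\<^sub>R v) has_derivative (\<lambda>t. t *\<^sub>R v)) (at (0::real))"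
      by (auto intro!: derivative_eq_intros)
    from has_derivative_compose[OF this, of \<Psi> "\<lambda>x. x"] dPs
    show ?thesis by (simp add: has_vector_derivative_def)
  qed
  have "((\<lambda>t. p + t *\<^sub>R v) \<longlongrightarrow> p + 0 *\<^sub>R v) (nhds (0::real))"
    by (intro tendsto_intros) (auto simp: filterlim_ident)
  then have "\<forall>\<^sub>F t in nhds (0::real). p + t *\<^sub>R v \<in> V"
    using I(4,5) Pp by (auto dest: topological_tendstoD)
  then have "\<forall>\<^sub>F t in nhds (0::real). \<Psi> (p + t *\<^sub>R v) \<in> S"
  proof eventually_elim
    case (elim t)
    define x where "x = \<Psi> (p + t *\<^sub>R v)"
    have xU: "x \<in> U'" and px: "\<Phi> x = p + t *\<^sub>R v"
      unfolding x_def using homeomorphism_apply2[OF I(6) elim] homeomorphism_image2[OF I(6)] elim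
      by blast+
    have "G p \<bullet> (\<Phi> x - p) = F x"
      using c by (simp add: \<Phi>_def inner_diff_right inner_add_right c_def)
    then have "F x = 0" using px v by simp
    then show ?case using S(1) xU I(2) unfolding x_def by blast
  qed
  then show "v \<in> tangent_space S p"
    unfolding tangent_space_def using gder Psp
    by (intro CollectI exI[of _ "\<lambda>t. \<Psi> (p + t *\<^sub>R v)"]) simp
qed

lemma C2_hypersurfaceE:
  fixes S :: "'a::euclidean_space set"
  assumes "C2_hypersurface S" "p \<in> S"
  obtains U F G and H :: "'a \<Rightarrow> 'a \<Rightarrow>\<^sub>L 'a" where "open U" "p \<in> U"
    "\<And>x. x \<in> U \<Longrightarrow> (F has_derivative (\<lambda>h. G x \<bullet> h)) (at x)"
    "\<And>x. x \<in> U \<Longrightarrow> (G has_derivative blinfun_apply (H x)) (at x)"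
    "continuous_on U H" "\<And>x. x \<in> U \<Longrightarrow> G x \<noteq> 0"
    "S \<inter> U = {x \<in> U. F x = 0}"
    "\<And>x. x \<in> S \<inter> U \<Longrightarrow> tangent_space S x = {v. G x \<bullet> v = 0}"
proof -
  obtain U F where U: "open U" "p \<in> U" "C2_on F U"
    "\<And>x. x \<in> U \<Longrightarrow> frechet_derivative F (at x) \<noteq> (\<lambda>h. 0)" "S \<inter> U = {x \<in> U. F x = 0}"
    using bspec[OF assms(1)[unfolded C2_hypersurface_def] assms(2)] by (elim exE conjE) (rule that, auto)
  obtain G and H :: "'a \<Rightarrow> 'a \<Rightarrow>\<^sub>L 'a" where G:
    "\<And>x. x \<in> U \<Longrightarrow> (F has_derivative (\<lambda>h. G x \<bullet> h)) (at x)"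
    "\<And>x. x \<in> U \<Longrightarrow> (G has_derivative blinfun_apply (H x)) (at x)"
    "continuous_on U H"
    by (rule C2_onE[OF U(3,1)]) (rule that)
  have nz: "G x \<noteq> 0" if "x \<in> U" for x
    using U(4)[OF that] frechet_derivative_at[OF G(1)[OF that]] by auto
  have cG: "continuous_on U G"
    using G(2) by (meson continuous_at_imp_continuous_on has_derivative_continuous)
  show thesis
  proof (rule that)
    show "tangent_space S x = {v. G x \<bullet> v = 0}" if "x \<in> S \<inter> U" for x
      using that by (intro tangent_space_level_set[OF U(1) _ G(1) cG nz U(5)]) auto
  qed (fact U(1,2,5) G nz)+
qed

lemma orthonormal_basis_expand:
  assumes "orthonormal_basis_of B T" "x \<in> T"
  shows "x = (\<Sum>e\<in>B. (x \<bullet> e) *\<^sub>R e)"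
proof -
  have B: "pairwise orthogonal B" "\<And>e. e \<in> B \<Longrightarrow> norm e = 1" "span B = T"
    using assms by (auto simp: orthonormal_basis_of_def)
  have fin: "finite B" using B(1)
    by (rule pairwise_orthogonal_imp_finite)
  define y where "y = x - (\<Sum>e\<in>B. (x \<bullet> e) *\<^sub>R e)"
  have "y \<bullet> f = 0" if "f \<in> B" for f
  proof -
    have "(\<Sum>e\<in>B. (x \<bullet> e) *\<^sub>R e) \<bullet> f = (\<Sum>e\<in>B. if e = f then x \<bullet> f else 0)"
      unfolding inner_sum_left
    proof (rule sum.cong)
      fix e assume "e \<in> B"
      moreover have "f \<bullet> f = 1" using B(2)[OF that] by (simp only: norm_eq_1)
      ultimately show "(x \<bullet> e) *\<^sub>R e \<bullet> f = (if e = f then x \<bullet> f else 0)"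
        using B(1) that by (simp add: pairwise_def orthogonal_def)
    qed simp
    also have "\<dots> = x \<bullet> f" using fin that by simp
    finally show ?thesis by (simp add: y_def inner_diff_left)
  qed
  moreover have "y \<in> span B"
    unfolding y_def
  proof (rule span_diff)
    show "x \<in> span B" using assms(2) B(3) by simp
    show "(\<Sum>e\<in>B. (x \<bullet> e) *\<^sub>R e) \<in> span B"
      by (intro span_sum span_scale span_base)
  qed
  ultimately have "orthogonal y y"
    using orthogonal_to_span[of y B y] by (simp add: orthogonal_def)
  then show ?thesis by (simp add: orthogonal_def y_def)
qed

lemma trace_basis_independent:
  assumes B: "orthonormal_basis_of B T" "orthonormal_basis_of C T" and L: "linear L"
  shows "(\<Sum>e\<in>B. L e \<bullet> e) = (\<Sum>f\<in>C. L f \<bullet> f)"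
proof -
  have sub: "B \<subseteq> T" "C \<subseteq> T"
    using B span_superset unfolding orthonormal_basis_of_def by blast+
  have "(\<Sum>e\<in>B. L e \<bullet> e) = (\<Sum>e\<in>B. \<Sum>f\<in>C. (e \<bullet> f) * (L f \<bullet> e))"
  proof (rule sum.cong)
    fix e assume "e \<in> B"
    then have "e = (\<Sum>f\<in>C. (e \<bullet> f) *\<^sub>R f)"
      using orthonormal_basis_expand[OF B(2)] sub by blast
    from arg_cong[where f = L, OF this]
    have Le: "L e = (\<Sum>f\<in>C. (e \<bullet> f) *\<^sub>R L f)"
      by (simp only: linear_sum[OF L] linear_scale[OF L])
    show "L e \<bullet> e = (\<Sum>f\<in>C. (e \<bullet> f) * (L f \<bullet> e))"
      by (subst Le) (simp add: inner_sum_left)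
  qed simp
  also have "\<dots> = (\<Sum>f\<in>C. L f \<bullet> (\<Sum>e\<in>B. (f \<bullet> e) *\<^sub>R e))"
    by (subst sum.swap) (simp add: inner_sum_right inner_commute)
  also have "\<dots> = (\<Sum>f\<in>C. L f \<bullet> f)"
  proof (rule sum.cong)
    fix f assume "f \<in> C"
    then have "f = (\<Sum>e\<in>B. (f \<bullet> e) *\<^sub>R e)"
      using orthonormal_basis_expand[OF B(1)] sub by blast
    then show "L f \<bullet> (\<Sum>e\<in>B. (f \<bullet> e) *\<^sub>R e) = L f \<bullet> f"
      by (rule arg_cong[where f = "(\<bullet>) (L f)", OF sym])
  qed simp
  finally show ?thesis .
qed

lemma second_fundamental_form_unique:
  fixes S :: "'a::euclidean_space set"
  assumes S: "C2_hypersurface S" "p \<in> S"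
    and n1: "unit_normal_field S U1 n1" "p \<in> U1"
    and n2: "unit_normal_field S U2 n2" "p \<in> U2"
    and u: "u \<in> tangent_space S p"
  shows "second_fundamental_form n1 p u v = second_fundamental_form n2 p u v"
proof -
  obtain U F G and H :: "'a \<Rightarrow> 'a \<Rightarrow>\<^sub>L 'a" where U: "open U" "p \<in> U"
    and "\<And>x. x \<in> U \<Longrightarrow> (F has_derivative (\<lambda>h. G x \<bullet> h)) (at x)"
    and dG: "\<And>x. x \<in> U \<Longrightarrow> (G has_derivative blinfun_apply (H x)) (at x)"
    and "continuous_on U H"
    and nz: "\<And>x. x \<in> U \<Longrightarrow> G x \<noteq> 0"
    and "S \<inter> U = {x \<in> U. F x = 0}"
    and T: "\<And>x. x \<in> S \<inter> U \<Longrightarrow> tangent_space S x = {v. G x \<bullet> v = 0}"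
    by (rule C2_hypersurfaceE[OF S]) (rule that)
  have par: "n x = (n x \<bullet> m x) *\<^sub>R m x \<and> \<bar>n x \<bullet> m x\<bar> = 1"
    if nm: "unit_normal_field S V n" "unit_normal_field S W m"
      "x \<in> S" "x \<in> U" "x \<in> V" "x \<in> W"
    for V W n m x
  proof -
    have *: "k x = ((k x \<bullet> G x) / (G x \<bullet> G x)) *\<^sub>R G x"
      if k: "unit_normal_field S X k" "x \<in> X" for X k
    proof -
      define w where "w = k x - ((k x \<bullet> G x) / (G x \<bullet> G x)) *\<^sub>R G x"
      have w: "G x \<bullet> w = 0"
        using nz[OF \<open>x \<in> U\<close>] by (simp add: w_def inner_diff_right inner_commute)
      then have "k x \<bullet> w = 0"
        using k T \<open>x \<in> S\<close> \<open>x \<in> U\<close> by (auto simp: unit_normal_field_def)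
      then have "w \<bullet> w = 0"
        using w by (simp add: w_def inner_diff_left)
      then show ?thesis by (simp add: w_def)
    qed
    obtain a b where ab: "n x = a *\<^sub>R G x" "m x = b *\<^sub>R G x"
      using *[OF nm(1,5)] *[OF nm(2,6)] by metis
    have 1: "norm (n x) = 1" "norm (m x) = 1"
      using nm by (auto simp: unit_normal_field_def)
    have sq: "b * b * (G x \<bullet> G x) = 1"
    proof -
      have "m x \<bullet> m x = 1" using 1(2) by (simp only: norm_eq_1)
      then show ?thesis by (simp add: ab mult.assoc)
    qed
    have e: "n x = (n x \<bullet> m x) *\<^sub>R m x"
    proof -
      have "(n x \<bullet> m x) *\<^sub>R m x = (a * (b * b * (G x \<bullet> G x))) *\<^sub>R G x"
        by (simp add: ab algebra_simps)
      then show ?thesis by (simp add: sq ab)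
    qed
    have "norm (n x) = \<bar>n x \<bullet> m x\<bar> * norm (m x)"
      by (subst e) simp
    with e 1 show ?thesis by simp
  qed
  define s where "s = n1 p \<bullet> n2 p"
  have s: "n1 p = s *\<^sub>R n2 p" "\<bar>s\<bar> = 1"
    using par[OF n1(1) n2(1) S(2) U(2) n1(2) n2(2)] by (auto simp: s_def)
  have op: "open U1" "open U2" using n1 n2 by (auto simp: unit_normal_field_def)
  have d: "n1 differentiable at p" "n2 differentiable at p"
    using n1 n2 op by (auto simp: unit_normal_field_def differentiable_on_eq_differentiable_at)
  obtain \<gamma> where g: "\<gamma> 0 = p" "\<forall>\<^sub>F t in nhds (0::real). \<gamma> t \<in> S"
     "(\<gamma> has_vector_derivative u) (at 0)"
    using u unfolding tangent_space_def by blast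
  have gc: "isCont \<gamma> 0" using g(3) has_vector_derivative_continuous by blast
  have gt: "(\<gamma> \<longlongrightarrow> p) (nhds 0)"
    using gc g(1) by (metis isCont_def tendsto_at_iff_tendsto_nhds)
  have ev1: "\<forall>\<^sub>F t in nhds 0. \<gamma> t \<in> U \<inter> U1 \<inter> U2"
    using gt U op n1(2) n2(2) by (intro topological_tendstoD) auto
  have gd: "((\<lambda>t. n (\<gamma> t)) has_derivative (\<lambda>h. frechet_derivative n (at p) (h *\<^sub>R u))) (at 0)"
    if "n differentiable at p" for n :: "'a \<Rightarrow> 'a"
    using has_derivative_compose[of \<gamma> "\<lambda>h. h *\<^sub>R u" 0 UNIV n "frechet_derivative n (at p)"]
      g(1,3) that by (simp add: has_vector_derivative_def frechet_derivative_works)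
  have gcont: "((\<lambda>t. n (\<gamma> t)) \<longlongrightarrow> n p) (nhds 0)" if "n differentiable at p" for n :: "'a \<Rightarrow> 'a"
    using has_derivative_continuous[OF gd[OF that]] g(1)
    by (metis isCont_def tendsto_at_iff_tendsto_nhds)
  have "((\<lambda>t. s * (n1 (\<gamma> t) \<bullet> n2 (\<gamma> t))) \<longlongrightarrow> s * s) (nhds 0)"
    using gcont[OF d(1)] gcont[OF d(2)] unfolding s_def by (intro tendsto_intros)
  moreover have ss: "s * s = 1" using s(2) by (metis abs_mult_self_eq mult_1)
  ultimately have "\<forall>\<^sub>F t in nhds 0. s * (n1 (\<gamma> t) \<bullet> n2 (\<gamma> t)) > 0"
    by (intro order_tendstoD) auto
  then have ev: "\<forall>\<^sub>F t in nhds 0. n1 (\<gamma> t) = s *\<^sub>R n2 (\<gamma> t)"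
    using ev1 g(2)
  proof eventually_elim
    case (elim t)
    let ?x = "\<gamma> t"
    have q: "n1 ?x = (n1 ?x \<bullet> n2 ?x) *\<^sub>R n2 ?x" "\<bar>n1 ?x \<bullet> n2 ?x\<bar> = 1"
      using par[OF n1(1) n2(1), of ?x] elim by auto
    have "n1 ?x \<bullet> n2 ?x = s"
      using q(2) s(2) elim(1) by (auto simp: abs_if split: if_splits)
    then show ?case using q(1) by simp
  qed
  have "((\<lambda>t. n1 (\<gamma> t)) has_derivative
      (\<lambda>h. s *\<^sub>R frechet_derivative n2 (at p) (h *\<^sub>R u))) (at 0)"
    by (rule has_derivative_transform_eventually
        [OF has_derivative_scaleR_right[OF gd[OF d(2)], of s]])
       (use ev eventually_nhds_x_imp_x[OF ev] in
        \<open>auto simp: eventually_at_filter elim: eventually_mono\<close>)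
  with gd[OF d(1)] have "(\<lambda>h. frechet_derivative n1 (at p) (h *\<^sub>R u)) =
      (\<lambda>h. s *\<^sub>R frechet_derivative n2 (at p) (h *\<^sub>R u))"
    by (rule has_derivative_unique)
  from fun_cong[OF this, of 1]
  have "frechet_derivative n1 (at p) u = s *\<^sub>R frechet_derivative n2 (at p) u" by simp
  then show ?thesis
    unfolding second_fundamental_form_def using ss s(1) by simp
qed

lemma unit_normal_field_exists:
  fixes S :: "'a::euclidean_space set"
  assumes "C2_hypersurface S" "p \<in> S"
  obtains U \<nu> where "p \<in> U" "unit_normal_field S U \<nu>"
proof -
  obtain U F G and H :: "'a \<Rightarrow> 'a \<Rightarrow>\<^sub>L 'a" where U: "open U" "p \<in> U"
    and "\<And>x. x \<in> U \<Longrightarrow> (F has_derivative (\<lambda>h. G x \<bullet> h)) (at x)"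
    and dG: "\<And>x. x \<in> U \<Longrightarrow> (G has_derivative blinfun_apply (H x)) (at x)"
    and "continuous_on U H"
    and nz: "\<And>x. x \<in> U \<Longrightarrow> G x \<noteq> 0"
    and "S \<inter> U = {x \<in> U. F x = 0}"
    and T: "\<And>x. x \<in> S \<inter> U \<Longrightarrow> tangent_space S x = {v. G x \<bullet> v = 0}"
    by (rule C2_hypersurfaceE[OF assms]) (rule that)
  have "(\<lambda>x. inverse (norm (G x)) *\<^sub>R G x) differentiable_on U"
    unfolding differentiable_on_eq_differentiable_at[OF U(1)]
  proof
    fix x assume x: "x \<in> U"
    have "G differentiable at x" using dG[OF x] differentiable_def by blast
    moreover have "(\<lambda>x. norm (G x)) differentiable at x"
      using differentiable_compose[OF differentiable_norm_at[OF nz[OF x]] \<open>G differentiable at x\<close>] .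
    ultimately show "(\<lambda>x. inverse (norm (G x)) *\<^sub>R G x) differentiable at x"
      using nz[OF x] by (intro differentiable_scaleR differentiable_inverse) auto
  qed
  then have "unit_normal_field S U (\<lambda>x. inverse (norm (G x)) *\<^sub>R G x)"
    unfolding unit_normal_field_def using U(1) nz T by auto
  then show thesis using that U(2) by blast
qed

theorem has_mean_curvature_vector_ex1:
  assumes "C2_hypersurface S" "p \<in> S"
  shows "\<exists>!h. has_mean_curvature_vector S p h"
proof -
  have "subspace (tangent_space S p)"
  proof -
    obtain U F G and H :: "'a \<Rightarrow> 'a \<Rightarrow>\<^sub>L 'a" where "open U" "p \<in> U"
      and "\<And>x. x \<in> U \<Longrightarrow> (F has_derivative (\<lambda>h. G x \<bullet> h)) (at x)"
      and dG: "\<And>x. x \<in> U \<Longrightarrow> (G has_derivative blinfun_apply (H x)) (at x)"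
      and "continuous_on U H"
      and nz: "\<And>x. x \<in> U \<Longrightarrow> G x \<noteq> 0"
      and "S \<inter> U = {x \<in> U. F x = 0}"
      and T: "\<And>x. x \<in> S \<inter> U \<Longrightarrow> tangent_space S x = {v. G x \<bullet> v = 0}"
      by (rule C2_hypersurfaceE[OF assms]) (rule that)
    then have "tangent_space S p = {v. G p \<bullet> v = 0}" using assms(2) by blast
    then show ?thesis by (simp add: subspace_hyperplane)
  qed
  then obtain B where "orthonormal_basis_of B (tangent_space S p)"
    unfolding orthonormal_basis_of_def using orthonormal_basis_subspace by metis
  moreover obtain U \<nu> where "p \<in> U" "unit_normal_field S U \<nu>"
    using unit_normal_field_exists[OF assms] .
  ultimately have ex: "\<exists>h. has_mean_curvature_vector S p h"
    unfolding has_mean_curvature_vector_def by blast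
  have "h1 = h2" if h: "has_mean_curvature_vector S p h1" "has_mean_curvature_vector S p h2"
    for h1 h2
  proof -
    obtain U1 n1 B1 where 1: "p \<in> U1" "unit_normal_field S U1 n1"
      "orthonormal_basis_of B1 (tangent_space S p)"
      "h1 = (\<Sum>e\<in>B1. second_fundamental_form n1 p e e)"
      using h(1) unfolding has_mean_curvature_vector_def by blast
    obtain U2 n2 B2 where 2: "p \<in> U2" "unit_normal_field S U2 n2"
      "orthonormal_basis_of B2 (tangent_space S p)"
      "h2 = (\<Sum>e\<in>B2. second_fundamental_form n2 p e e)"
      using h(2) unfolding has_mean_curvature_vector_def by blast
    have sub: "B1 \<subseteq> tangent_space S p"
      using 1(3) span_superset unfolding orthonormal_basis_of_def by blast
    have "n2 differentiable at p"
      using 2(1,2) by (auto simp: unit_normal_field_def differentiable_on_eq_differentiable_at)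
    then have lin: "linear (frechet_derivative n2 (at p))"
      by (rule linear_frechet_derivative)
    have "h1 = (\<Sum>e\<in>B1. second_fundamental_form n2 p e e)"
      unfolding 1(4) using second_fundamental_form_unique[OF assms 1(2,1) 2(2,1)] sub
      by (intro sum.cong) auto
    also have "\<dots> = - (\<Sum>e\<in>B1. frechet_derivative n2 (at p) e \<bullet> e) *\<^sub>R n2 p"
      unfolding second_fundamental_form_def by (simp add: scaleR_sum_left sum_negf)
    also have "\<dots> = - (\<Sum>e\<in>B2. frechet_derivative n2 (at p) e \<bullet> e) *\<^sub>R n2 p"
      using trace_basis_independent[OF 1(3) 2(3) lin] by simp
    also have "\<dots> = h2"
      unfolding 2(4) second_fundamental_form_def by (simp add: scaleR_sum_left sum_negf)
    finally show ?thesis .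
  qed
  with ex show ?thesis by blast
qed

end

theory Submission
  imports Defs
begin

text \<open>
  Write the hypersurface locally as \<open>F = 0\<close> with gradient \<open>G\<close> and Hessian \<open>H\<close>. Minimality of its
  image under the dilation by \<open>t\<close> is the vanishing of a sum over the pairs \<open>{i, j}\<close> of
  \<open>t powr (- 2 * (g i + g j))\<close> times \<open>Q (G\<^sub>i e\<^sub>j - G\<^sub>j e\<^sub>i)\<close>, where \<open>Q\<close> is the quadratic form of \<open>H\<close>;
  the diagonal terms cancel. By nonresonance the exponents are distinct, so a sum of this kind
  with as many zeros as terms has vanishing coefficients. Where no \<open>G\<^sub>i\<close> vanishes, the vanishing of
  \<open>Q\<close> on all \<open>e\<^sub>i / G\<^sub>i - e\<^sub>j / G\<^sub>j\<close> forces \<open>Q = 0\<close> on the tangent space. In general one argues by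
  induction on the number of vanishing \<open>G\<^sub>k\<close>: either the point is a limit of points with fewer
  zeros, or the same \<open>G\<^sub>k\<close> vanish on a neighbourhood in the hypersurface, so that \<open>H u \<bullet> e\<^sub>k = 0\<close> for
  every tangent \<open>u\<close>. Thus the second fundamental form is zero and the unit normal is locally constant.
\<close>

section \<open>Zeros of exponential sums\<close>

lemma rolle_finite_zeros:
  fixes f f' :: "real \<Rightarrow> real"
  assumes f: "\<And>x. (f has_real_derivative f' x) (at x)"
    and T: "finite T" "\<And>x. x \<in> T \<Longrightarrow> f x = 0"
  obtains T' where "finite T'" "card T \<le> Suc (card T')" "\<And>x. x \<in> T' \<Longrightarrow> f' x = 0"
proof -
  \<comment> \<open>The clause \<open>\<exists>t\<in>T. x < t\<close> keeps all earlier Rolle points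
    below the maximum of the zeros treated so far. The next Rolle point lies beyond that maximum, so
    it is new and the count goes up.\<close>
  have "\<exists>T'. finite T' \<and> card T \<le> Suc (card T') \<and> (\<forall>x\<in>T'. f' x = 0 \<and> (\<exists>t\<in>T. x < t))"
    using T
  proof (induction T rule: finite_linorder_max_induct)
    case empty
    show ?case by (intro exI[of _ "{}"]) simp
  next
    case (insert b A)
    then obtain T' where T': "finite T'" "card A \<le> Suc (card T')"
      "\<forall>x\<in>T'. f' x = 0 \<and> (\<exists>t\<in>A. x < t)" by auto
    show ?case
    proof (cases "A = {}")
      case True
      then show ?thesis by (intro exI[of _ "{}"]) simp
    next
      case False
      define a where "a = Max A"
      have a: "a \<in> A" "\<And>t. t \<in> A \<Longrightarrow> t \<le> a"
        using insert.hyps(1) False by (auto simp: a_def)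
      have "\<exists>z>a. z < b \<and> f' z = 0"
      proof (rule Rolle_deriv[where f = f and f' = "\<lambda>x h. f' x * h", THEN exE])
        show "a < b" using a insert.hyps by blast
        show "f a = f b" using insert.prems a by simp
        show "continuous_on {a..b} f"
          using f by (meson DERIV_continuous_on has_field_derivative_at_within)
        show "(f has_derivative (*) (f' x)) (at x)" for x
          using f[of x] by (simp add: has_field_derivative_def)
        fix z assume "a < z \<and> z < b \<and> (*) (f' z) = (\<lambda>v. 0)"
        then show ?thesis by (metis mult.right_neutral)
      qed
      then obtain z where z: "a < z" "z < b" "f' z = 0" by blast
      have "z \<notin> T'" using T'(3) a(2) z(1) by force
      moreover have "b \<notin> A" using insert.hyps by blast
      ultimately show ?thesis
        using T' z insert.hyps by (intro exI[of _ "insert z T'"]) auto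
    qed
  qed
  then show thesis using that by blast
qed

text \<open>Multiplying by \<open>exp (- l a * x)\<close> makes the term of \<open>a\<close>
  constant without moving any zero. Differentiation then removes this term, and by Rolle it costs at
  most one zero, so induction on the number of terms applies to the derivative, whose exponents
  \<open>l b - l a\<close> are still distinct.\<close>

lemma exponential_sum_coeffs_zero:
  fixes c l :: "'a \<Rightarrow> real"
  assumes "finite A" "inj_on l A" "finite T" "card A \<le> card T"
    and "\<And>x. x \<in> T \<Longrightarrow> (\<Sum>a\<in>A. c a * exp (l a * x)) = 0" and "a \<in> A"
  shows "c a = 0"
proof -
  have "\<forall>a\<in>A. c a = 0"
    using assms(1-5)
  proof (induction A arbitrary: c l T rule: finite_induct)
    case (insert a A)
    define f where "f x = (\<Sum>b\<in>insert a A. c b * exp ((l b - l a) * x))" for x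
    define f' where "f' x = (\<Sum>b\<in>A. (c b * (l b - l a)) * exp ((l b - l a) * x))" for x
    have fx: "f x = (\<Sum>b\<in>insert a A. c b * exp (l b * x)) * exp (- l a * x)" for x
      unfolding f_def sum_distrib_right
      by (simp add: mult.assoc flip: exp_add) (simp add: algebra_simps)
    have der: "(f has_real_derivative f' x) (at x)" for x
      unfolding f_def f'_def using insert.hyps
      by (auto intro!: derivative_eq_intros sum.cong)
    have z: "f x = 0" if "x \<in> T" for x
      unfolding fx using insert.prems(4)[OF that] by simp
    obtain T' where T': "finite T'" "card T \<le> Suc (card T')" "\<And>x. x \<in> T' \<Longrightarrow> f' x = 0"
      using rolle_finite_zeros[OF der insert.prems(2) z] by blast
    have "\<forall>b\<in>A. c b * (l b - l a) = 0"
    proof (rule insert.IH[of "\<lambda>b. l b - l a" T'])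
      show "inj_on (\<lambda>b. l b - l a) A"
        using insert.prems(1) by (auto simp: inj_on_def)
      show "card A \<le> card T'" using insert.prems(3) insert.hyps T'(2) by simp
    qed (use T' in \<open>auto simp: f'_def\<close>)
    moreover have "l b \<noteq> l a" if "b \<in> A" for b
      using insert.prems(1) insert.hyps that by (auto simp: inj_on_def)
    ultimately have A: "\<forall>b\<in>A. c b = 0" by auto
    \<comment> \<open>The other coefficients are gone, so a single zero is enough for that of
      \<open>a\<close>; the bound on the cardinality provides one.\<close>
    have "T \<noteq> {}" using insert.prems(3) insert.hyps by auto
    then obtain x where x: "x \<in> T" by blast
    have "c a * exp (l a * x) = 0"
      using insert.prems(4)[OF x] insert.hyps A by simp
    then show ?case using A by simp
  qed simp
  then show ?thesis using assms(6) by blast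
qed

section \<open>Symmetry of the Hessian\<close>

text \<open>The second difference \<open>\<Delta>\<close> is symmetric in \<open>u\<close> and
  \<open>v\<close>, and divided by \<open>s\<^sup>2\<close> it tends to
  \<open>D u \<bullet> v\<close> as \<open>s\<close> decreases to 0. This works with
  differentiability of the gradient at the point \<open>p\<close> alone, without continuity of the
  second derivative.\<close>

lemma hessian_symmetric:
  fixes F :: "'a::real_inner \<Rightarrow> real"
  assumes U: "open U" "p \<in> U"
    and F: "\<And>x. x \<in> U \<Longrightarrow> (F has_derivative (\<lambda>h. G x \<bullet> h)) (at x)"
    and G: "(G has_derivative D) (at p)"
  shows "D u \<bullet> v = D v \<bullet> u"
proof -
  define \<Delta> where "\<Delta> u v s = F (p + s *\<^sub>R u + s *\<^sub>R v) - F (p + s *\<^sub>R u) - F (p + s *\<^sub>R v) + F p"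
    for u v s
  have lin: "linear D" using G has_derivative_linear by blast
  have key: "\<exists>d>0. \<forall>s. 0 < s \<and> s < d \<longrightarrow> \<bar>\<Delta> u v s - s\<^sup>2 * (D u \<bullet> v)\<bar> \<le> e * s\<^sup>2"
    if e: "e > 0" for e u v
  proof -
    \<comment> \<open>All points of the parallelogram spanned by \<open>s *\<^sub>R u\<close> and
      \<open>s *\<^sub>R v\<close> at \<open>p\<close> are within \<open>s * M\<close> of
      \<open>p\<close>; the summand 1 keeps \<open>M\<close> positive. In \<open>e'\<close> the
      factor 2 pays for the two remainders \<open>R1\<close> and \<open>R2\<close>, and
      \<open>M\<^sup>2\<close> for the bound on their argument and for
      \<open>norm v\<close>.\<close>
    define M where "M = norm u + norm v + 1"
    have M: "M > 0" unfolding M_def by (meson add_nonneg_pos norm_ge_zero add_nonneg_nonneg zero_less_one)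
    define e' where "e' = e / (2 * M\<^sup>2)"
    have e': "e' > 0" using e M by (simp add: e'_def)
    obtain d1 where d1: "d1 > 0"
      "\<And>y. norm (y - p) < d1 \<Longrightarrow> norm (G y - G p - D (y - p)) \<le> e' * norm (y - p)"
      using G e' unfolding has_derivative_at_alt by blast
    obtain r where r: "r > 0" "ball p r \<subseteq> U" using U openE by blast
    have "\<bar>\<Delta> u v s - s\<^sup>2 * (D u \<bullet> v)\<bar> \<le> e * s\<^sup>2" if s: "0 < s" "s < min d1 r / M" for s
    proof -
      have sM: "s * M < d1" "s * M < r" using s M by (auto simp: field_simps)
      have small: "norm (a *\<^sub>R u + b *\<^sub>R v) \<le> s * M" if "0 \<le> a" "a \<le> s" "0 \<le> b" "b \<le> s" for a b
      proof -
        have "norm (a *\<^sub>R u + b *\<^sub>R v) \<le> a * norm u + b * norm v"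
          using norm_triangle_ineq[of "a *\<^sub>R u" "b *\<^sub>R v"] that by simp
        also have "\<dots> \<le> s * norm u + s * norm v"
          using that by (intro add_mono mult_right_mono) auto
        also have "\<dots> \<le> s * M" using s by (simp add: M_def algebra_simps)
        finally show ?thesis .
      qed
      have inU: "p + a *\<^sub>R u + b *\<^sub>R v \<in> U" if "0 \<le> a" "a \<le> s" "0 \<le> b" "b \<le> s" for a b
        using small[OF that] sM r(2)
        by (auto intro!: subsetD[OF r(2)] simp: dist_norm norm_minus_commute add.assoc)
          (metis add.commute add_diff_cancel_left' diff_minus_eq_add minus_add norm_minus_cancel le_less_trans)
      have R: "norm (G (p + a *\<^sub>R u + b *\<^sub>R v) - G p - (a *\<^sub>R D u + b *\<^sub>R D v)) \<le> e' * (s * M)"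
        if "0 \<le> a" "a \<le> s" "0 \<le> b" "b \<le> s" for a b
      proof -
        have "norm (G (p + a *\<^sub>R u + b *\<^sub>R v) - G p - D (a *\<^sub>R u + b *\<^sub>R v)) 
            \<le> e' * norm (a *\<^sub>R u + b *\<^sub>R v)"
          using d1(2)[of "p + a *\<^sub>R u + b *\<^sub>R v"] small[OF that] sM by (simp add: add.assoc)
        also have "\<dots> \<le> e' * (s * M)" using small[OF that] e' by simp
        finally show ?thesis by (simp add: linear_add[OF lin] linear_scale[OF lin])
      qed
      \<comment> \<open>\<open>\<phi>\<close> compares \<open>F\<close> on the two sides parallel to
        \<open>v\<close>. One mean value step in this direction turns \<open>\<Delta>\<close> into a
        difference of two gradients, to which the first-order expansion of \<open>G\<close> at
        \<open>p\<close> applies. The summand \<open>0 *\<^sub>R u\<close> brings both sides into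
        the form of \<open>inU\<close> and \<open>R\<close>.\<close>
      define \<phi> where "\<phi> r = F (p + s *\<^sub>R u + (r * s) *\<^sub>R v) - F (p + 0 *\<^sub>R u + (r * s) *\<^sub>R v)" for r
      define \<phi>' where "\<phi>' r = (G (p + s *\<^sub>R u + (r * s) *\<^sub>R v) - G (p + 0 *\<^sub>R u + (r * s) *\<^sub>R v)) \<bullet> (s *\<^sub>R v)" for r
      have der: "(\<phi> has_derivative (\<lambda>h. h * \<phi>' r)) (at r within {0..1})" if "0 \<le> r" "r \<le> 1" for r
      proof -
        have rs: "0 \<le> r * s" "r * s \<le> s" using that s by (auto simp: mult_left_le_one_le)
        have c: "((\<lambda>r. F (p + a *\<^sub>R u + (r * s) *\<^sub>R v)) has_derivative
            (\<lambda>h. G (p + a *\<^sub>R u + (r * s) *\<^sub>R v) \<bullet> ((h * s) *\<^sub>R v))) (at r within {0..1})"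
          if "0 \<le> a" "a \<le> s" for a
          by (rule has_derivative_compose[where g = F and f = "\<lambda>r. p + a *\<^sub>R u + (r * s) *\<^sub>R v"
              and f' = "\<lambda>h. (h * s) *\<^sub>R v", OF _ F[OF inU[OF that rs]]])
            (auto intro!: derivative_eq_intros)
        show ?thesis
          unfolding \<phi>_def \<phi>'_def
          by (rule has_derivative_eq_rhs[OF has_derivative_diff[OF c c]])
            (use s in \<open>auto simp: fun_eq_iff inner_diff_left algebra_simps\<close>)
      qed
      obtain r where r: "r \<in> {0<..<1}" "\<phi> 1 - \<phi> 0 = \<phi>' r"
        using mvt_simple[of 0 1 \<phi> "\<lambda>r h. h * \<phi>' r"] der by auto
      have rs: "0 \<le> r * s" "r * s \<le> s" using r s by (auto simp: mult_left_le_one_le)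
      define R1 where "R1 = G (p + s *\<^sub>R u + (r * s) *\<^sub>R v) - G p - (s *\<^sub>R D u + (r * s) *\<^sub>R D v)"
      define R2 where "R2 = G (p + 0 *\<^sub>R u + (r * s) *\<^sub>R v) - G p - (0 *\<^sub>R D u + (r * s) *\<^sub>R D v)"
      have nR: "norm R1 \<le> e' * (s * M)" "norm R2 \<le> e' * (s * M)"
        unfolding R1_def R2_def using rs s by (intro R; simp)+
      have "\<Delta> u v s = \<phi> 1 - \<phi> 0" by (simp add: \<Delta>_def \<phi>_def)
      also have "\<dots> = (s *\<^sub>R D u + R1 - R2) \<bullet> (s *\<^sub>R v)"
        unfolding r(2) \<phi>'_def R1_def R2_def by (simp add: algebra_simps)
      finally have "\<Delta> u v s - s\<^sup>2 * (D u \<bullet> v) = s * ((R1 - R2) \<bullet> v)"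
        by (simp add: algebra_simps power2_eq_square)
      also have "\<bar>\<dots>\<bar> \<le> s * (norm (R1 - R2) * norm v)"
        using Cauchy_Schwarz_ineq2[of "R1 - R2" v] s by (simp add: abs_mult)
      also have "\<dots> \<le> s * ((2 * (e' * (s * M))) * M)"
        using norm_triangle_ineq4[of R1 R2] nR s e' M
        by (intro mult_left_mono mult_mono) (auto simp: M_def)
      also have "\<dots> = e * s\<^sup>2" using M by (simp add: e'_def power2_eq_square)
      finally show ?thesis .
    qed
    moreover have "min d1 r / M > 0" using d1 r M by simp
    ultimately show ?thesis by blast
  qed
  have "\<bar>D u \<bullet> v - D v \<bullet> u\<bar> \<le> 0 + e" if e: "e > 0" for e
  proof -
    obtain d where d: "d > 0"
      "\<And>s. 0 < s \<and> s < d \<Longrightarrow> \<bar>\<Delta> u v s - s\<^sup>2 * (D u \<bullet> v)\<bar> \<le> e/2 * s\<^sup>2"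
      using key[of "e/2" u v] e by auto
    obtain d' where d': "d' > 0"
      "\<And>s. 0 < s \<and> s < d' \<Longrightarrow> \<bar>\<Delta> v u s - s\<^sup>2 * (D v \<bullet> u)\<bar> \<le> e/2 * s\<^sup>2"
      using key[of "e/2" v u] e by auto
    define s where "s = min d d' / 2"
    have s: "0 < s" "s < d" "s < d'" using d(1) d'(1) by (auto simp: s_def)
    have sym: "\<Delta> v u s = \<Delta> u v s" by (simp add: \<Delta>_def algebra_simps)
    have "\<bar>s\<^sup>2 * (D u \<bullet> v) - s\<^sup>2 * (D v \<bullet> u)\<bar> \<le> e * s\<^sup>2"
      using d(2)[of s] d'(2)[of s] s unfolding sym by linarith
    then have "s\<^sup>2 * \<bar>D u \<bullet> v - D v \<bullet> u\<bar> \<le> s\<^sup>2 * e"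
      by (metis abs_mult abs_power2 mult.commute right_diff_distrib)
    then show ?thesis using s by simp
  qed
  then have "\<bar>D u \<bullet> v - D v \<bullet> u\<bar> \<le> 0" by (rule field_le_epsilon)
  then show ?thesis by simp
qed

section \<open>Level set charts and the minimality criterion in terms of gradient and
  Hessian\<close>

text \<open>Gradient and Hessian are parameters and not chosen from \<open>F\<close>, so that the
  transported chart of a dilated hypersurface is an instance with explicit \<open>G\<close> and
  \<open>H\<close>.\<close>

locale level_set_chart =
  fixes S U :: "'a::euclidean_space set" and F :: "'a \<Rightarrow> real" and G :: "'a \<Rightarrow> 'a"
    and H :: "'a \<Rightarrow> 'a \<Rightarrow>\<^sub>L 'a"
  assumes open_U: "open U"
    and F: "\<And>x. x \<in> U \<Longrightarrow> (F has_derivative (\<lambda>h. G x \<bullet> h)) (at x)"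
    and G: "\<And>x. x \<in> U \<Longrightarrow> (G has_derivative blinfun_apply (H x)) (at x)"
    and H: "continuous_on U H"
    and nz: "\<And>x. x \<in> U \<Longrightarrow> G x \<noteq> 0"
    and S: "S \<inter> U = {x \<in> U. F x = 0}"
begin

lemma cont_G: "continuous_on U G"
  using G by (meson continuous_at_imp_continuous_on has_derivative_continuous)

lemma tangent: "x \<in> S \<inter> U \<Longrightarrow> tangent_space S x = {v. G x \<bullet> v = 0}"
  by (intro tangent_space_level_set[OF open_U _ F cont_G nz S]) auto

definition normal :: "'a \<Rightarrow> 'a" where
  "normal x = inverse (norm (G x)) *\<^sub>R G x"

lemma normal_derivative:
  assumes "x \<in> U"
  shows "(normal has_derivative (\<lambda>h. inverse (norm (G x)) *\<^sub>R H x h -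
    (inverse (norm (G x)) * (sgn (G x) \<bullet> H x h) * inverse (norm (G x))) *\<^sub>R G x)) (at x)"
  unfolding normal_def
  by (rule has_derivative_eq_rhs,
      rule has_derivative_scaleR[OF Deriv.has_derivative_inverse
        [OF _ has_derivative_compose[OF G[OF assms] has_derivative_norm]] G[OF assms]])
    (use nz[OF assms] in \<open>auto simp: inner_commute\<close>)

lemma norm_normal: "x \<in> U \<Longrightarrow> norm (normal x) = 1"
  using nz by (simp add: normal_def)

lemma unit_normal_field_normal: "unit_normal_field S U normal"
  unfolding unit_normal_field_def
proof (intro conjI ballI open_U)
  show "normal differentiable_on U"
    unfolding differentiable_on_eq_differentiable_at[OF open_U]
    using normal_derivative differentiable_def by blast
  fix x assume x: "x \<in> S \<inter> U"
  then show "norm (normal x) = 1" using norm_normal by blast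
  show "normal x \<bullet> v = 0" if "v \<in> tangent_space S x" for v
    using that tangent[OF x] by (simp add: normal_def)
qed

text \<open>Paired with tangent vectors, the derivative of the unit normal is \<open>H p\<close>
  divided by \<open>norm (G p)\<close>. Hence the mean curvature is a multiple of the tangential
  trace of \<open>H p\<close>, which is the full trace minus the value on the unit normal. Clearing
  denominators leaves a polynomial equation in \<open>G p\<close> and \<open>H p\<close> that refers
  to no basis of the tangent space.\<close>

lemma mean_curvature_vector_eq_0_iff:
  assumes C2: "C2_hypersurface S" and p: "p \<in> S" "p \<in> U"
  shows "mean_curvature_vector S p = 0 \<longleftrightarrow>
    (G p \<bullet> G p) * (\<Sum>b\<in>Basis. H p b \<bullet> b) = H p (G p) \<bullet> G p"
proof -
  have T: "tangent_space S p = {v. G p \<bullet> v = 0}" using tangent p by blast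
  then have "subspace (tangent_space S p)" by (simp add: subspace_hyperplane)
  then obtain B where B: "orthonormal_basis_of B (tangent_space S p)"
    unfolding orthonormal_basis_of_def using orthonormal_basis_subspace by metis
  then have BT: "G p \<bullet> e = 0" if "e \<in> B" for e
    using that T span_superset unfolding orthonormal_basis_of_def by blast
  have finB: "finite B"
    using B pairwise_orthogonal_imp_finite unfolding orthonormal_basis_of_def by blast
  define n where "n = normal p"
  define c where "c = inverse (norm (G p))"
  have c: "c \<noteq> 0" and n: "n = c *\<^sub>R G p" "norm n = 1"
    using nz p norm_normal by (auto simp: c_def n_def normal_def)
  have cc: "c * c * (G p \<bullet> G p) = 1"
    using nz[OF p(2)] by (simp add: c_def dot_square_norm power2_eq_square field_simps)
  define \<tau> where "\<tau> = (\<Sum>e\<in>B. H p e \<bullet> e)"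
  have fd: "frechet_derivative normal (at p) = (\<lambda>h. inverse (norm (G p)) *\<^sub>R H p h -
      (inverse (norm (G p)) * (sgn (G p) \<bullet> H p h) * inverse (norm (G p))) *\<^sub>R G p)"
    using frechet_derivative_at[OF normal_derivative[OF p(2)]] by simp
  have "has_mean_curvature_vector S p (\<Sum>e\<in>B. second_fundamental_form normal p e e)"
    unfolding has_mean_curvature_vector_def using p(2) unit_normal_field_normal B by blast
  then have "mean_curvature_vector S p = (\<Sum>e\<in>B. second_fundamental_form normal p e e)"
    unfolding mean_curvature_vector_def
    using has_mean_curvature_vector_ex1[OF C2 p(1)] by (metis the1_equality)
  also have "\<dots> = (\<Sum>e\<in>B. - (c * (H p e \<bullet> e)) *\<^sub>R n)"
    by (intro sum.cong) (auto simp: second_fundamental_form_def fd inner_diff_left BT c_def n_def)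
  also have "\<dots> = - (c * \<tau>) *\<^sub>R n"
    by (simp add: \<tau>_def sum_distrib_left sum_negf scaleR_sum_left)
  finally have "mean_curvature_vector S p = 0 \<longleftrightarrow> \<tau> = 0"
    using c n(2) by auto
  \<comment> \<open>Adjoining \<open>n\<close> to \<open>B\<close> gives an orthonormal basis of the
    whole space, and the trace is the same in every orthonormal basis.\<close>
  moreover have "(\<Sum>b\<in>Basis. H p b \<bullet> b) = \<tau> + H p n \<bullet> n"
  proof -
    have nB: "\<And>e. e \<in> B \<Longrightarrow> n \<bullet> e = 0"
      using BT by (simp add: n)
    then have "n \<notin> B" using n(2) by fastforce
    note nB = this nB
    have onb: "orthonormal_basis_of (insert n B) UNIV"
      unfolding orthonormal_basis_of_def
    proof (intro conjI)
      show "pairwise orthogonal (insert n B)"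
        using B nB by (auto simp: orthonormal_basis_of_def pairwise_insert orthogonal_def inner_commute)
      show "\<forall>e\<in>insert n B. norm e = 1"
        using B n(2) by (auto simp: orthonormal_basis_of_def)
      have "x \<in> span (insert n B)" for x
      proof -
        have "G p \<bullet> (x - (x \<bullet> n) *\<^sub>R n) = (1 - c * c * (G p \<bullet> G p)) * (x \<bullet> G p)"
          by (simp add: n inner_diff_right algebra_simps inner_commute)
        then have "x - (x \<bullet> n) *\<^sub>R n \<in> span B"
          using T B cc by (simp add: orthonormal_basis_of_def)
        then show ?thesis by (auto simp: span_insert)
      qed
      then show "span (insert n B) = UNIV" by blast
    qed
    have "orthonormal_basis_of (Basis::'a set) UNIV"
      by (auto simp: orthonormal_basis_of_def pairwise_def orthogonal_def inner_Basis)
    then have "(\<Sum>b\<in>Basis. H p b \<bullet> b) = (\<Sum>e\<in>insert n B. H p e \<bullet> e)"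
      by (rule trace_basis_independent[OF _ onb blinfun.bounded_linear_right[THEN bounded_linear.linear]])
    then show ?thesis using nB finB by (simp add: \<tau>_def)
  qed
  moreover have "(G p \<bullet> G p) * (H p n \<bullet> n) = H p (G p) \<bullet> G p"
  proof -
    have "(G p \<bullet> G p) * (H p n \<bullet> n) = (c * c * (G p \<bullet> G p)) * (H p (G p) \<bullet> G p)"
      by (simp add: n blinfun.scaleR_right)
    then show ?thesis by (simp add: cc)
  qed
  ultimately show ?thesis using nz[OF p(2)] by (auto simp: distrib_left)
qed

end

section \<open>Minimality of the dilated images and the resulting relation for each pair of
  coordinates\<close>

text \<open>The substitution \<open>x = -2 * ln t\<close> turns the weight of \<open>m i j\<close>
  into \<open>exp ((g i + g j) * x)\<close>. The ordered pairs \<open>(i, j)\<close> and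
  \<open>(j, i)\<close> share this exponent, so what can be isolated is the symmetrised coefficient;
  nonresonance separates it from those of all other two-element sets.\<close>

lemma pair_coeffs_zero:
  fixes m :: "'n::finite \<Rightarrow> 'n \<Rightarrow> real"
  assumes g: "pair_sum_nonresonant g" and T: "finite T" "T \<subseteq> {0<..}" "CARD('n) choose 2 \<le> card T"
    and diag: "\<And>i. m i i = 0"
    and sum0: "\<And>t. t \<in> T \<Longrightarrow> (\<Sum>i\<in>UNIV. \<Sum>j\<in>UNIV. t powr (-2 * g i) * t powr (-2 * g j) * m i j) = 0"
    and ij: "i \<noteq> j"
  shows "m i j + m j i = 0"
proof -
  define A where "A = {P :: 'n set. card P = 2}"
  define W where "W = {(i::'n, j). i \<noteq> j}"
  define pr where "pr = (\<lambda>(i::'n, j). {i, j})"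
  define c where "c P = (\<Sum>x\<in>{x \<in> W. pr x = P}. case_prod m x)" for P
  have cA: "card A = CARD('n) choose 2"
    unfolding A_def using n_subsets[of "UNIV :: 'n set" 2] by simp
  have cT: "card ((\<lambda>t. -2 * ln t) ` T) = card T"
    by (rule card_image) (rule inj_on_subset[OF _ T(2)], auto simp: inj_on_def)
  have sum_exp: "(\<Sum>P\<in>A. c P * exp ((\<Sum>i\<in>P. g i) * x)) = 0" if "x \<in> (\<lambda>t. -2 * ln t) ` T" for x
  proof -
    from that obtain t where t: "t \<in> T" "x = -2 * ln t" by blast
    have t0: "t > 0" using t T by auto
    define f where "f = (\<lambda>(i, j). t powr (-2 * g i) * t powr (-2 * g j) * m i j)"
    have "0 = (\<Sum>y\<in>UNIV \<times> UNIV. f y)"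
      using sum0[OF t(1)] by (simp add: sum.cartesian_product f_def)
    \<comment> \<open>The diagonal has to go first: its exponents \<open>2 * g i\<close> may
      coincide with pair sums, since nonresonance only concerns two-element sets.\<close>
    also have "\<dots> = (\<Sum>y\<in>W. f y)"
      by (rule sum.mono_neutral_right) (auto simp: W_def f_def diag)
    also have "\<dots> = (\<Sum>P\<in>A. sum f {x \<in> W. pr x = P})"
      by (rule sum.group[symmetric]) (auto simp: W_def pr_def A_def)
    also have "\<dots> = (\<Sum>P\<in>A. c P * exp ((\<Sum>i\<in>P. g i) * x))"
      unfolding c_def sum_distrib_right
      by (intro sum.cong refl)
        (auto simp: f_def W_def pr_def t(2) powr_def t0 t0[THEN less_imp_neq, symmetric] algebra_simps simp flip: exp_add)
    finally show ?thesis by simp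
  qed
  have "c {i, j} = 0"
  proof (rule exponential_sum_coeffs_zero[where A = A and l = "\<lambda>P. \<Sum>i\<in>P. g i"])
    show "card A \<le> card ((\<lambda>t. -2 * ln t) ` T)"
      using cA cT T(3) by simp
    show "inj_on (\<lambda>P. \<Sum>i\<in>P. g i) A"
      using g by (simp add: pair_sum_nonresonant_def A_def)
  qed (use T(1) ij sum_exp in \<open>simp_all add: A_def\<close>)
  moreover have "{x \<in> W. pr x = {i, j}} = {(i, j), (j, i)}"
    using ij by (auto simp: W_def pr_def doubleton_eq_iff)
  ultimately show ?thesis using ij by (simp add: c_def)
qed

lemma dilation_inverse:
  assumes "t > 0"
  shows "dilation (\<lambda>i. - g i) t (dilation g t x) = x" "dilation g t (dilation (\<lambda>i. - g i) t x) = x"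
  using assms by (auto simp: dilation_def vec_eq_iff powr_minus field_simps)

lemma dilation_self_adjoint: "dilation g t x \<bullet> y = x \<bullet> dilation g t y"
  by (simp add: dilation_def inner_vec_def algebra_simps)

lemma bounded_linear_dilation: "bounded_linear (dilation g t)"
  unfolding linear_conv_bounded_linear[symmetric]
  by (rule linearI) (auto simp: dilation_def vec_eq_iff algebra_simps)

lemma dilation_image_eq:
  assumes "t > 0"
  shows "dilation g t ` S = dilation (\<lambda>i. - g i) t -` S"
proof safe
  show "x \<in> dilation g t ` S" if "dilation (\<lambda>i. - g i) t x \<in> S" for x
    using imageI[OF that, of "dilation g t"] by (simp add: dilation_inverse[OF assms])
qed (simp add: dilation_inverse[OF assms])

text \<open>The image is the zero set of \<open>F\<close> composed with the inverse dilation
  \<open>E\<close>. As \<open>E\<close> is self-adjoint, the chain rule produces gradient and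
  Hessian by composing with \<open>E\<close> itself, with no transpose.\<close>

lemma level_set_chart_dilation:
  fixes S :: "(real^'n) set" and g :: "'n \<Rightarrow> real"
  assumes "level_set_chart S U F G H" and t: "t > 0"
  defines "E \<equiv> dilation (\<lambda>i. - g i) t"
  shows "level_set_chart (dilation g t ` S) (E -` U) (\<lambda>y. F (E y)) (\<lambda>y. E (G (E y)))
    (\<lambda>y. Blinfun E o\<^sub>L (H (E y) o\<^sub>L Blinfun E))"
proof -
  interpret level_set_chart S U F G H by fact
  have E: "bounded_linear E" unfolding E_def by (rule bounded_linear_dilation)
  have contE: "continuous_on A E" for A
    using E by (rule linear_continuous_on)
  have dE: "(E has_derivative E) (at y)" for y
    using bounded_linear_imp_has_derivative[OF E] .
  show ?thesis
  proof
    show "open (E -` U)"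
      using open_vimage[OF open_U contE] .
    show "((\<lambda>y. F (E y)) has_derivative (\<lambda>h. E (G (E y)) \<bullet> h)) (at y)" if "y \<in> E -` U" for y
    proof -
      have "((\<lambda>y. F (E y)) has_derivative (\<lambda>h. G (E y) \<bullet> E h)) (at y)"
        using has_derivative_compose[OF dE F] that by simp
      then show ?thesis by (simp add: E_def dilation_self_adjoint)
    qed
    show "((\<lambda>y. E (G (E y))) has_derivative blinfun_apply (Blinfun E o\<^sub>L (H (E y) o\<^sub>L Blinfun E))) (at y)"
      if "y \<in> E -` U" for y
    proof -
      have "((\<lambda>y. E (G (E y))) has_derivative (\<lambda>h. E (H (E y) (E h)))) (at y)"
        using bounded_linear.has_derivative[OF E has_derivative_compose[OF dE G]] that by simp
      moreover have "blinfun_apply (Blinfun E o\<^sub>L (H (E y) o\<^sub>L Blinfun E)) = (\<lambda>h. E (H (E y) (E h)))"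
        by (rule ext) (simp add: bounded_linear_Blinfun_apply[OF E])
      ultimately show ?thesis by simp
    qed
    show "continuous_on (E -` U) (\<lambda>y. Blinfun E o\<^sub>L (H (E y) o\<^sub>L Blinfun E))"
      by (intro continuous_intros continuous_on_compose2[OF H contE]) auto
    show "E (G (E y)) \<noteq> 0" if "y \<in> E -` U" for y
      using nz[of "E y"] that dilation_inverse(2)[OF t, of g "G (E y)"]
      by (auto simp: E_def dilation_def vec_eq_iff)
    show "dilation g t ` S \<inter> E -` U = {y \<in> E -` U. F (E y) = 0}"
      using S unfolding dilation_image_eq[OF t] E_def by blast
  qed
qed

lemma sum_Basis_vec: "(\<Sum>b\<in>Basis. f (b :: real^'n)) = (\<Sum>i\<in>UNIV. f (axis i 1))"
proof -
  have B: "Basis = range (\<lambda>i::'n. axis i (1::real))"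
    by (auto simp: Basis_vec_def)
  have "inj (\<lambda>i::'n. axis i (1::real))"
    by (auto simp: inj_on_def axis_eq_axis)
  then show ?thesis unfolding B by (simp add: sum.reindex)
qed

lemma inner_linear_expand:
  fixes L :: "real^'n \<Rightarrow> real^'n"
  assumes "linear L"
  shows "L u \<bullet> v = (\<Sum>i\<in>UNIV. \<Sum>j\<in>UNIV. u $ i * v $ j * L (axis i 1) $ j)"
proof -
  have "u = (\<Sum>i\<in>UNIV. u $ i *\<^sub>R axis i 1)"
    using basis_expansion[of u] by (simp add: scalar_mult_eq_scaleR)
  from arg_cong[where f = L, OF this] have "L u = (\<Sum>i\<in>UNIV. u $ i *\<^sub>R L (axis i 1))"
    by (simp add: linear_sum[OF assms] linear_scale[OF assms])
  then have "L u \<bullet> v = (\<Sum>i\<in>UNIV. u $ i * (L (axis i 1) \<bullet> v))"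
    by (simp add: inner_sum_left)
  also have "\<dots> = (\<Sum>i\<in>UNIV. \<Sum>j\<in>UNIV. u $ i * v $ j * L (axis i 1) $ j)"
    by (simp add: inner_vec_def sum_distrib_left algebra_simps)
  finally show ?thesis .
qed

text \<open>In the criterion at the image of \<open>p\<close>, the map \<open>E\<close> can be
  collected into \<open>E\<close> applied twice, which multiplies the coordinates by
  \<open>t powr (-2 * g i)\<close>. Expanding both sides into double sums leaves summands that
  vanish for \<open>i = j\<close>.\<close>

lemma minimal_dilation_equation:
  fixes S :: "(real^'n) set" and g :: "'n \<Rightarrow> real"
  assumes chart: "level_set_chart S U F G H" and p: "p \<in> S" "p \<in> U" and t: "t > 0"
    and min: "minimal_hypersurface (dilation g t ` S)"
  shows "(\<Sum>i\<in>UNIV. \<Sum>j\<in>UNIV. t powr (-2 * g i) * t powr (-2 * g j) *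
    ((G p $ i)\<^sup>2 * H p (axis j 1) $ j - G p $ i * G p $ j * H p (axis i 1) $ j)) = 0"
proof -
  define E where "E = dilation (\<lambda>i. - g i) t"
  define e where "e i = t powr (-2 * g i)" for i
  have ee: "t powr - g i * t powr - g i = e i" for i
    by (simp add: e_def flip: powr_add)
  have E: "bounded_linear E" unfolding E_def by (rule bounded_linear_dilation)
  have EE: "E (E x) $ i = e i * x $ i" for x i
    using ee[of i] by (simp add: E_def dilation_def flip: mult.assoc)
  interpret D: level_set_chart "dilation g t ` S" "E -` U" "\<lambda>y. F (E y)" "\<lambda>y. E (G (E y))"
    "\<lambda>y. Blinfun E o\<^sub>L (H (E y) o\<^sub>L Blinfun E)"
    using level_set_chart_dilation[OF chart t] unfolding E_def .
  have Ep: "E (dilation g t p) = p" using t by (simp add: E_def dilation_inverse)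
  have adj: "E x \<bullet> y = x \<bullet> E y" for x y by (simp add: E_def dilation_self_adjoint)
  have lin: "linear (blinfun_apply (H p))"
    by (simp add: blinfun.bounded_linear_right bounded_linear.linear)
  have Eax: "E (axis j 1) = t powr (- g j) *\<^sub>R axis j 1" for j
    by (simp add: E_def dilation_def vec_eq_iff axis_def)
  have "dilation g t p \<in> dilation g t ` S" using p by blast
  moreover have "C2_hypersurface (dilation g t ` S)" "mean_curvature_vector (dilation g t ` S) (dilation g t p) = 0"
    using min p by (auto simp: minimal_hypersurface_def)
  ultimately have "(E (G p) \<bullet> E (G p)) * (\<Sum>b\<in>Basis. E (H p (E b)) \<bullet> b) = E (H p (E (E (G p)))) \<bullet> E (G p)"
    using D.mean_curvature_vector_eq_0_iff[of "dilation g t p"] p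
    by (simp add: Ep bounded_linear_Blinfun_apply[OF E])
  moreover have "E (G p) \<bullet> E (G p) = (\<Sum>i\<in>UNIV. e i * (G p $ i)\<^sup>2)"
    unfolding adj by (simp add: inner_vec_def EE power2_eq_square algebra_simps)
  moreover have "(\<Sum>b\<in>Basis. E (H p (E b)) \<bullet> b) = (\<Sum>j\<in>UNIV. e j * H p (axis j 1) $ j)"
    unfolding sum_Basis_vec
    unfolding adj Eax by (simp add: blinfun.scaleR_right inner_axis mult.assoc flip: ee)
  moreover have "E (H p (E (E (G p)))) \<bullet> E (G p) =
      (\<Sum>i\<in>UNIV. \<Sum>j\<in>UNIV. e i * e j * (G p $ i * G p $ j * H p (axis i 1) $ j))"
    unfolding adj inner_linear_expand[OF lin] EE by (simp add: algebra_simps)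
  ultimately have "(\<Sum>i\<in>UNIV. e i * (G p $ i)\<^sup>2) * (\<Sum>j\<in>UNIV. e j * H p (axis j 1) $ j) =
     (\<Sum>i\<in>UNIV. \<Sum>j\<in>UNIV. e i * e j * (G p $ i * G p $ j * H p (axis i 1) $ j))" by simp
  then show ?thesis
    unfolding e_def[symmetric] sum_product right_diff_distrib sum_subtractf
    by (simp add: algebra_simps)
qed

text \<open>For the quadratic form of \<open>H p\<close> this is its vanishing on
  \<open>G p $ i\<close> times \<open>axis j 1\<close> minus \<open>G p $ j\<close> times
  \<open>axis i 1\<close>, a vector in a coordinate plane that is orthogonal to
  \<open>G p\<close>.\<close>

lemma pairwise_quadratic_relation:
  fixes S :: "(real^'n) set" and g :: "'n \<Rightarrow> real"
  assumes chart: "level_set_chart S U F G H" and p: "p \<in> S" "p \<in> U"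
    and g: "pair_sum_nonresonant g" and T: "finite T" "T \<subseteq> {0<..}" "CARD('n) choose 2 \<le> card T"
    and min: "\<And>t. t \<in> T \<Longrightarrow> minimal_hypersurface (dilation g t ` S)"
    and ij: "i \<noteq> j"
  shows "(G p $ i)\<^sup>2 * H p (axis j 1) $ j + (G p $ j)\<^sup>2 * H p (axis i 1) $ i =
    G p $ i * G p $ j * (H p (axis i 1) $ j + H p (axis j 1) $ i)"
proof -
  define m where "m i j = (G p $ i)\<^sup>2 * H p (axis j 1) $ j - G p $ i * G p $ j * H p (axis i 1) $ j" for i j
  have "m i j + m j i = 0"
  proof (rule pair_coeffs_zero[OF g T])
    show "m i i = 0" for i by (simp add: m_def power2_eq_square)
    show "(\<Sum>i\<in>UNIV. \<Sum>j\<in>UNIV. t powr (-2 * g i) * t powr (-2 * g j) * m i j) = 0" if "t \<in> T" for t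
      unfolding m_def using minimal_dilation_equation[OF chart p _ min[OF that]] T(2) that by auto
  qed fact
  then show ?thesis by (simp add: m_def algebra_simps)
qed

section \<open>Vanishing of the second fundamental form\<close>

text \<open>Assumption \<open>Z\<close> allows \<open>u\<close> and \<open>v\<close> to be cut off
  where \<open>G\<close> vanishes. On the remaining indices \<open>pair\<close> says that
  \<open>h i j\<close> is \<open>G i * G j\<close> times the mean of \<open>k i\<close> and
  \<open>k j\<close>. The double sum thus splits into two products, each containing one of the
  factors that vanish by \<open>u\<close> and \<open>v\<close>.\<close>

lemma bilinear_form_zero:
  fixes h :: "'n::finite \<Rightarrow> 'n \<Rightarrow> real" and G :: "'n \<Rightarrow> real"
  assumes sym: "\<And>i j. h i j = h j i"
    and pair: "\<And>i j. i \<noteq> j \<Longrightarrow> (G i)\<^sup>2 * h j j + (G j)\<^sup>2 * h i i = 2 * G i * G j * h i j"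
    and Z: "\<And>k u. G k = 0 \<Longrightarrow> (\<Sum>i\<in>UNIV. u i * G i) = 0 \<Longrightarrow> (\<Sum>j\<in>UNIV. h k j * u j) = 0"
    and u: "(\<Sum>i\<in>UNIV. u i * G i) = 0" and v: "(\<Sum>i\<in>UNIV. v i * G i) = 0"
  shows "(\<Sum>i\<in>UNIV. \<Sum>j\<in>UNIV. u i * v j * h i j) = 0"
proof -
  define u' where "u' i = (if G i = 0 then 0 else u i)" for i
  define v' where "v' i = (if G i = 0 then 0 else v i)" for i
  have uv': "u' i * G i = u i * G i" "v' i * G i = v i * G i" for i by (auto simp: u'_def v'_def)
  \<comment> \<open>If \<open>G i = 0\<close>, the quotient has its default value 0; below,
    \<open>k i\<close> only occurs together with a factor \<open>G i\<close>.\<close>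
  define k where "k i = h i i / (G i)\<^sup>2" for i
  have "(\<Sum>i\<in>UNIV. \<Sum>j\<in>UNIV. u i * v j * h i j) = (\<Sum>i\<in>UNIV. u i * (\<Sum>j\<in>UNIV. h i j * v j))"
    by (simp add: sum_distrib_left algebra_simps)
  also have "\<dots> = (\<Sum>i\<in>UNIV. u' i * (\<Sum>j\<in>UNIV. h i j * v j))"
    by (intro sum.cong refl) (simp add: u'_def Z[OF _ v])
  also have "\<dots> = (\<Sum>i\<in>UNIV. \<Sum>j\<in>UNIV. v j * (h j i * u' i))"
    by (simp add: sum_distrib_left algebra_simps sym)
  also have "\<dots> = (\<Sum>j\<in>UNIV. v j * (\<Sum>i\<in>UNIV. h j i * u' i))"
    by (subst sum.swap) (simp add: sum_distrib_left)
  \<comment> \<open>The second use of \<open>Z\<close> is with \<open>u'\<close>, which is still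
    orthogonal to \<open>G\<close> because it differs from \<open>u\<close> only where
    \<open>G\<close> vanishes.\<close>
  also have "\<dots> = (\<Sum>j\<in>UNIV. v' j * (\<Sum>i\<in>UNIV. h j i * u' i))"
    by (intro sum.cong refl) (simp add: v'_def Z uv' u)
  also have "\<dots> = (\<Sum>j\<in>UNIV. \<Sum>i\<in>UNIV. (1/2 * (v j * G j)) * (k i * (u i * G i)) + (1/2 * k j * (v j * G j)) * (u i * G i))"
    unfolding sum_distrib_left
  proof (intro sum.cong refl)
    fix i j
    show "v' j * (h j i * u' i) = (1/2 * (v j * G j)) * (k i * (u i * G i)) + (1/2 * k j * (v j * G j)) * (u i * G i)"
    proof (cases "G i = 0 \<or> G j = 0")
      case True
      then show ?thesis by (auto simp: u'_def v'_def)
    next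
      case False
      have "h j i = (k i + k j) / 2 * G i * G j"
      proof (cases "i = j")
        case True
        then show ?thesis using False by (simp add: k_def power2_eq_square)
      next
        case ne: False
        have "2 * G i * G j * h j i = (k i + k j) * G i * G j * G i * G j"
          using pair[OF ne] False by (simp add: k_def sym[of j i] power2_eq_square field_simps)
        then have "(2 * G i * G j) * h j i = (2 * G i * G j) * ((k i + k j) / 2 * G i * G j)"
          by (simp add: algebra_simps)
        then show ?thesis using False by simp
      qed
      then show ?thesis using False by (simp add: u'_def v'_def field_simps)
    qed
  qed
  also have "\<dots> = 0"
    unfolding sum.distrib sum_distrib_left[symmetric] sum_distrib_right[symmetric]
    by (simp add: u v)
  finally show ?thesis .
qed

lemma level_set_chart_hessian_symmetric:
  assumes "level_set_chart S U F G H" "x \<in> U"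
  shows "H x u \<bullet> v = H x v \<bullet> u"
proof -
  interpret level_set_chart S U F G H by fact
  show ?thesis by (rule hessian_symmetric[OF open_U assms(2) F G[OF assms(2)]])
qed

text \<open>At a single point the pair relations may be too weak: if \<open>G x $ i = 0\<close>,
  they contain no mixed entry of row \<open>i\<close> of the Hessian. The missing entries come from
  neighbouring points of \<open>S\<close>, which is why the relations are assumed on all of
  \<open>S \<inter> U\<close>.\<close>

lemma second_fundamental_form_zero:
  fixes S :: "(real^'n) set"
  assumes chart: "level_set_chart S U F G H"
    and pair: "\<And>x i j. x \<in> S \<inter> U \<Longrightarrow> i \<noteq> j \<Longrightarrow>
      (G x $ i)\<^sup>2 * H x (axis j 1) $ j + (G x $ j)\<^sup>2 * H x (axis i 1) $ i =
      G x $ i * G x $ j * (H x (axis i 1) $ j + H x (axis j 1) $ i)"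
    and "x \<in> S \<inter> U" "G x \<bullet> u = 0" "G x \<bullet> v = 0"
  shows "H x u \<bullet> v = 0"
  using assms(3-)
proof (induction "card {k. G x $ k = 0}" arbitrary: x u v rule: less_induct)
  case less
  interpret level_set_chart S U F G H by fact
  have x: "x \<in> S" "x \<in> U" using less.prems by auto
  show ?case
  proof (cases "\<forall>W. open W \<longrightarrow> x \<in> W \<longrightarrow> (\<exists>y\<in>S \<inter> U \<inter> W. card {k. G y $ k = 0} < card {k. G x $ k = 0})")
    case True
    \<comment> \<open>\<open>P y\<close> projects orthogonally onto the tangent space at
      \<open>y\<close>. So \<open>f\<close> is continuous, equals \<open>H x u \<bullet> v\<close>
      at \<open>x\<close>, and is zero by induction at the points of \<open>S\<close> with fewer
      vanishing components, which accumulate at \<open>x\<close>.\<close>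
    define P where "P y w = w - ((G y \<bullet> w) / (G y \<bullet> G y)) *\<^sub>R G y" for y w
    have P: "G y \<bullet> P y w = 0" if "y \<in> U" for y w
      using nz[OF that] by (simp add: P_def inner_diff_right)
    define f where "f y = H y (P y u) \<bullet> P y v" for y
    have "continuous_on U f"
      unfolding f_def P_def using nz by (intro continuous_intros H cont_G) auto
    then have "open (U \<inter> f -` (- {0}))"
      by (rule continuous_open_preimage[OF _ open_U]) auto
    show ?thesis
    proof (rule ccontr)
      assume "H x u \<bullet> v \<noteq> 0"
      then have "x \<in> U \<inter> f -` (- {0})"
        using x less.prems by (simp add: f_def P_def)
      then obtain y where y: "y \<in> S \<inter> U" "f y \<noteq> 0" "card {k. G y $ k = 0} < card {k. G x $ k = 0}"
        using True \<open>open (U \<inter> f -` (- {0}))\<close> by blast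
      then show False
        using less.hyps[OF y(3,1) P P] by (auto simp: f_def)
    qed
  next
    case False
    then obtain W where W: "open W" "x \<in> W"
      "\<And>y. y \<in> S \<inter> U \<inter> W \<Longrightarrow> card {k. G x $ k = 0} \<le> card {k. G y $ k = 0}"
      by (meson not_less)
    \<comment> \<open>On \<open>V\<close> the components that are nonzero at \<open>x\<close> stay
      nonzero, so zeros can only be lost. On \<open>W\<close> their number cannot drop at points of
      \<open>S\<close>, hence the set of vanishing components is constant on
      \<open>S \<inter> V\<close>.\<close>
    define V where "V = (\<Inter>k\<in>{k. G x $ k \<noteq> 0}. U \<inter> (\<lambda>y. G y $ k) -` (- {0})) \<inter> U \<inter> W"
    have "open V"
      unfolding V_def
      by (intro open_Int open_INT ballI finite open_U W(1) continuous_open_preimage[OF _ open_U])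
        (auto intro!: continuous_intros cont_G)
    have xV: "x \<in> V" using x W(2) by (simp add: V_def)
    have G0: "G y $ k = 0" if "y \<in> S \<inter> V" "G x $ k = 0" for y k
    proof -
      have "{k. G y $ k = 0} \<subseteq> {k. G x $ k = 0}"
        using that(1) unfolding V_def by blast
      then have "{k. G y $ k = 0} = {k. G x $ k = 0}"
        using W(3)[of y] that by (intro card_seteq) (auto simp: V_def)
      then show ?thesis using that(2) by blast
    qed
    \<comment> \<open>The component \<open>k\<close> of \<open>G\<close> is zero along a curve in
      \<open>S\<close> with velocity \<open>w\<close>; differentiating this at \<open>x\<close>
      gives the claim.\<close>
    have Hk: "H x w $ k = 0" if w: "G x \<bullet> w = 0" and k: "G x $ k = 0" for w k
    proof -
      have "w \<in> tangent_space S x" using tangent[OF less.prems(1)] w by simp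
      then obtain \<gamma> where g: "\<gamma> 0 = x" "\<forall>\<^sub>F t in nhds (0::real). \<gamma> t \<in> S"
         "(\<gamma> has_vector_derivative w) (at 0)"
        unfolding tangent_space_def by blast
      have "isCont \<gamma> 0" using g(3) has_vector_derivative_continuous by blast
      then have "(\<gamma> \<longlongrightarrow> x) (nhds 0)"
        using g(1) by (metis isCont_def tendsto_at_iff_tendsto_nhds)
      then have "\<forall>\<^sub>F t in nhds 0. \<gamma> t \<in> V"
        using \<open>open V\<close> xV by (rule topological_tendstoD)
      then have ev: "\<forall>\<^sub>F t in nhds 0. 0 = G (\<gamma> t) $ k"
        using g(2) by eventually_elim (use G0 k in auto)
      have "((\<lambda>t. G (\<gamma> t)) has_derivative (\<lambda>h. H x (h *\<^sub>R w))) (at 0)"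
        using has_derivative_compose[of \<gamma> "\<lambda>h. h *\<^sub>R w" 0 UNIV G "H x"] g(1,3) G[OF x(2)]
        by (simp add: has_vector_derivative_def)
      then have "((\<lambda>t. G (\<gamma> t) $ k) has_derivative (\<lambda>h. H x (h *\<^sub>R w) $ k)) (at 0)"
        by (rule bounded_linear.has_derivative[OF bounded_linear_vec_nth])
      moreover have "((\<lambda>t. G (\<gamma> t) $ k) has_derivative (\<lambda>h. 0)) (at 0)"
        by (rule has_derivative_transform_eventually[OF has_derivative_const[of 0]])
          (use ev eventually_nhds_x_imp_x[OF ev] in \<open>auto simp: eventually_at_filter elim: eventually_mono\<close>)
      ultimately have "(\<lambda>h. H x (h *\<^sub>R w) $ k) = (\<lambda>h. 0)"
        by (rule has_derivative_unique)
      from fun_cong[OF this, of 1] show ?thesis by simp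
    qed
    have lin: "linear (blinfun_apply (H x))"
      by (simp add: blinfun.bounded_linear_right bounded_linear.linear)
    have sym: "H x (axis i 1) $ j = H x (axis j 1) $ i" for i j
      using level_set_chart_hessian_symmetric[OF chart x(2), of "axis i 1" "axis j 1"]
      by (simp add: inner_axis)
    have "(\<Sum>i\<in>UNIV. \<Sum>j\<in>UNIV. u $ i * v $ j * H x (axis i 1) $ j) = 0"
    proof (rule bilinear_form_zero[where G = "\<lambda>i. G x $ i"])
      show "H x (axis i 1) $ j = H x (axis j 1) $ i" for i j by (rule sym)
      show "(G x $ i)\<^sup>2 * H x (axis j 1) $ j + (G x $ j)\<^sup>2 * H x (axis i 1) $ i =
        2 * G x $ i * G x $ j * H x (axis i 1) $ j" if "i \<noteq> j" for i j
        using pair[OF less.prems(1) that] by (simp add: sym[of j i])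
      show "(\<Sum>j\<in>UNIV. H x (axis k 1) $ j * w j) = 0"
        if "G x $ k = 0" "(\<Sum>i\<in>UNIV. w i * G x $ i) = 0" for k and w :: "'n \<Rightarrow> real"
      proof -
        \<comment> \<open>\<open>Hk\<close> concerns a component of the image of a tangent vector;
          symmetry of the Hessian turns it into the row sum that \<open>bilinear_form_zero\<close>
          asks for.\<close>
        have "H x (\<chi> i. w i) $ k = 0"
          using that by (intro Hk) (simp_all add: inner_vec_def mult.commute)
        moreover have "H x (\<chi> i. w i) $ k = H x (\<chi> i. w i) \<bullet> axis k 1" by (simp add: inner_axis)
        moreover have "\<dots> = H x (axis k 1) \<bullet> (\<chi> i. w i)"
          by (rule level_set_chart_hessian_symmetric[OF chart x(2)])
        ultimately show ?thesis by (simp add: inner_vec_def)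
      qed
    qed (use less.prems in \<open>simp_all add: inner_vec_def mult.commute\<close>)
    then show ?thesis by (simp add: inner_linear_expand[OF lin])
  qed
qed

section \<open>From a vanishing second fundamental form to local flatness\<close>

context level_set_chart
begin

text \<open>The derivative of a unit vector field is orthogonal to it, so \<open>?d\<close> is
  orthogonal to \<open>G x\<close>. By flatness it is then orthogonal to \<open>H x \<tau>\<close>
  too. Being a combination of these two vectors, it is orthogonal to itself.\<close>

lemma normal_derivative_zero:
  assumes x: "x \<in> U" and flat: "\<And>v. G x \<bullet> v = 0 \<Longrightarrow> H x \<tau> \<bullet> v = 0"
  shows "inverse (norm (G x)) *\<^sub>R H x \<tau> -
    (inverse (norm (G x)) * (sgn (G x) \<bullet> H x \<tau>) * inverse (norm (G x))) *\<^sub>R G x = 0"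
    (is "?d = 0")
proof -
  define c where "c = inverse (norm (G x))"
  have cc: "c * c * (G x \<bullet> G x) = 1"
    using nz[OF x] by (simp add: c_def dot_square_norm power2_eq_square field_simps)
  have d: "?d = c *\<^sub>R H x \<tau> - (c * c * (G x \<bullet> H x \<tau>) * c) *\<^sub>R G x"
    by (simp add: c_def sgn_div_norm divide_inverse)
  have "G x \<bullet> ?d = c * (G x \<bullet> H x \<tau>) * (1 - c * c * (G x \<bullet> G x))"
    unfolding d by (simp add: algebra_simps)
  then have t: "G x \<bullet> ?d = 0" by (simp add: cc)
  have "?d \<bullet> ?d = c * (H x \<tau> \<bullet> ?d) - (c * c * (G x \<bullet> H x \<tau>) * c) * (G x \<bullet> ?d)"
    by (subst (1) d) (simp add: inner_diff_left)
  also have "\<dots> = 0" using flat[OF t] t by simp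
  finally show ?thesis by simp
qed

text \<open>The inverse function theorem presents \<open>S\<close> near \<open>p\<close> as a graph
  over its tangent hyperplane, so that nearby points of \<open>S\<close> are joined to
  \<open>p\<close> by curves inside \<open>S\<close>. Along these the unit normal is
  constant.\<close>

lemma locally_hyperplane:
  assumes p: "p \<in> S \<inter> U"
    and flat: "\<And>x u v. x \<in> S \<inter> U \<Longrightarrow> G x \<bullet> u = 0 \<Longrightarrow> G x \<bullet> v = 0 \<Longrightarrow> H x u \<bullet> v = 0"
  obtains W where "open W" "p \<in> W" "S \<inter> W = {x \<in> W. G p \<bullet> (x - p) = 0}"
proof -
  have pU: "p \<in> U" and F0: "F p = 0" using p S by auto
  define c where "c = G p \<bullet> G p"
  have c: "c \<noteq> 0" using nz[OF pU] by (simp add: c_def)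
  \<comment> \<open>\<open>\<Phi>\<close> shifts \<open>x\<close> along \<open>G p\<close> until the
    affine function \<open>G p \<bullet> (_ - p)\<close> takes the value \<open>F x\<close>. It
    flattens the level sets of \<open>F\<close>, has derivative the identity at \<open>p\<close>,
    and fixes the points where \<open>F\<close> already agrees with that function.\<close>
  define \<Phi> where "\<Phi> = (\<lambda>x. x + ((F x - G p \<bullet> (x - p)) / c) *\<^sub>R G p)"
  define D where "D = (\<lambda>x. id_blinfun + (blinfun_scaleR_left (G p) o\<^sub>L
      (blinfun_scaleR_right (1/c) o\<^sub>L blinfun_inner_left (G x - G p))))"
  have Dapp: "blinfun_apply (D x) h = h + ((G x \<bullet> h - G p \<bullet> h) / c) *\<^sub>R G p" for x h
    by (simp add: D_def blinfun.add_left inner_diff_left inner_diff_right inner_commute)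
  have der: "(\<Phi> has_derivative blinfun_apply (D x)) (at x)" if "x \<in> U" for x
  proof -
    have "(\<Phi> has_derivative (\<lambda>h. h + ((G x \<bullet> h - G p \<bullet> h) / c) *\<^sub>R G p)) (at x)"
      unfolding \<Phi>_def using c
      by (auto intro!: derivative_eq_intros F[OF that] simp: divide_inverse)
    then show ?thesis by (simp add: Dapp[abs_def])
  qed
  have cont: "continuous_on U D"
    unfolding D_def by (intro continuous_intros cont_G)
  have id: "id_blinfun o\<^sub>L D p = id_blinfun"
    by (rule blinfun_eqI) (simp add: Dapp)
  obtain U' V \<Psi> \<Psi>' where I: "open U'" "U' \<subseteq> U" "p \<in> U'" "open V" "\<Phi> p \<in> V"
      "homeomorphism U' V \<Phi> \<Psi>"
    "\<And>y. y \<in> V \<Longrightarrow> (\<Psi> has_derivative (\<Psi>' y)) (at y)"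
    "\<And>y. y \<in> V \<Longrightarrow> \<Psi>' y = inv (blinfun_apply (D (\<Psi> y)))"
    by (rule inverse_function_theorem[OF open_U der cont pU id]) (assumption, rule that)
  have Pp: "\<Phi> p = p" by (simp add: \<Phi>_def F0)
  have GPhi: "G p \<bullet> (\<Phi> x - p) = F x" for x
    using c by (simp add: \<Phi>_def inner_diff_right inner_add_right c_def)
  obtain r where r: "r > 0" "ball p r \<subseteq> V"
    using I(4,5) Pp by (metis openE)
  have PsiU: "\<Psi> y \<in> U" "\<Phi> (\<Psi> y) = y" if "y \<in> V" for y
    using I(2) homeomorphism_image2[OF I(6)] homeomorphism_apply2[OF I(6)] that by auto
  have FPsi: "F (\<Psi> y) = G p \<bullet> (y - p)" if "y \<in> V" for y
    using GPhi[of "\<Psi> y"] PsiU[OF that] by simp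
  \<comment> \<open>Differentiating \<open>FPsi\<close> shows that directions orthogonal to
    \<open>G p\<close> are carried to directions orthogonal to \<open>G (\<Psi> y)\<close>, on which
    flatness can be used.\<close>
  have GPsi: "G (\<Psi> y) \<bullet> \<Psi>' y w = G p \<bullet> w" if y: "y \<in> V" for y w
  proof -
    have "((\<lambda>y. F (\<Psi> y)) has_derivative (\<lambda>h. G (\<Psi> y) \<bullet> \<Psi>' y h)) (at y)"
      using has_derivative_compose[OF I(7)[OF y] F[OF PsiU(1)[OF y]]] .
    moreover have "((\<lambda>y. F (\<Psi> y)) has_derivative (\<lambda>h. G p \<bullet> h)) (at y)"
    proof (rule has_derivative_transform_within_open[OF _ I(4) y])
      show "((\<lambda>y. G p \<bullet> (y - p)) has_derivative (\<bullet>) (G p)) (at y)"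
        by (auto intro!: derivative_eq_intros)
    qed (simp add: FPsi)
    ultimately have "(\<lambda>h. G (\<Psi> y) \<bullet> \<Psi>' y h) = (\<lambda>h. G p \<bullet> h)"
      by (rule has_derivative_unique)
    then show ?thesis by (rule fun_cong)
  qed
  \<comment> \<open>\<open>\<Psi>\<close> parametrises \<open>S\<close> over its tangent hyperplane at \<open>p\<close>; along the segment from \<open>p\<close> to \<open>y\<close>
    the normal is constant, so the image curve stays in that hyperplane, where \<open>\<Phi>\<close> fixes \<open>S\<close>.\<close>
  have Psi_id: "\<Psi> y = y" "y \<in> S" if y: "y \<in> ball p r" "G p \<bullet> (y - p) = 0" for y
  proof -
    define w where "w = y - p"
    define \<gamma> where "\<gamma> s = p + s *\<^sub>R w" for s
    have g: "\<gamma> s \<in> V" if "s \<in> {0..1}" for s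
    proof -
      have "norm (s *\<^sub>R w) \<le> norm w" using that by (simp add: mult_left_le_one_le)
      also have "\<dots> < r" using y(1) by (simp add: w_def dist_norm norm_minus_commute)
      finally show ?thesis using r(2) by (auto simp: \<gamma>_def dist_norm)
    qed
    have gS: "\<Psi> (\<gamma> s) \<in> S \<inter> U" if "s \<in> {0..1}" for s
      using FPsi[OF g[OF that]] PsiU[OF g[OF that]] y(2) S by (auto simp: \<gamma>_def w_def)
    define \<tau> where "\<tau> s = \<Psi>' (\<gamma> s) w" for s
    have tan: "G (\<Psi> (\<gamma> s)) \<bullet> \<tau> s = 0" if "s \<in> {0..1}" for s
      using GPsi[OF g[OF that], of w] y(2) by (simp add: \<tau>_def w_def)
    have dg: "((\<lambda>s. \<Psi> (\<gamma> s)) has_derivative (\<lambda>h. h *\<^sub>R \<tau> s)) (at s within {0..1})"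
      if "s \<in> {0..1}" for s
    proof -
      have "(\<gamma> has_derivative (\<lambda>h. h *\<^sub>R w)) (at s within {0..1})"
        unfolding \<gamma>_def by (auto intro!: derivative_eq_intros)
      from has_derivative_compose[OF this I(7)[OF g[OF that]]]
      show ?thesis
        using linear_scale[OF has_derivative_linear[OF I(7)[OF g[OF that]]]] by (simp add: \<tau>_def)
    qed
    have dn: "((\<lambda>s. normal (\<Psi> (\<gamma> s))) has_derivative (\<lambda>h. 0)) (at s within {0..1})"
      if s: "s \<in> {0..1}" for s
    proof (rule has_derivative_eq_rhs[OF has_derivative_compose[OF dg[OF s] normal_derivative]])
      show U: "\<Psi> (\<gamma> s) \<in> U" using gS[OF s] by blast
      show "(\<lambda>h. inverse (norm (G (\<Psi> (\<gamma> s)))) *\<^sub>R H (\<Psi> (\<gamma> s)) (h *\<^sub>R \<tau> s) -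
          (inverse (norm (G (\<Psi> (\<gamma> s)))) * (sgn (G (\<Psi> (\<gamma> s))) \<bullet> H (\<Psi> (\<gamma> s)) (h *\<^sub>R \<tau> s)) *
           inverse (norm (G (\<Psi> (\<gamma> s))))) *\<^sub>R G (\<Psi> (\<gamma> s))) = (\<lambda>h. 0)"
        by (rule ext, rule normal_derivative_zero[OF U flat[OF gS[OF s]]])
          (use tan[OF s] in simp_all)
    qed
    have p0: "\<Psi> (\<gamma> 0) = p"
      using homeomorphism_apply1[OF I(6,3)] Pp by (simp add: \<gamma>_def)
    have n: "normal (\<Psi> (\<gamma> s)) = normal p" if "s \<in> {0..1}" for s
      using has_derivative_zero_unique[OF _ dn that, of 0] p0 by simp
    have "((\<lambda>s. normal p \<bullet> \<Psi> (\<gamma> s)) has_derivative (\<lambda>h. 0)) (at s within {0..1})" if s: "s \<in> {0..1}" for s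
    proof (rule has_derivative_eq_rhs[OF has_derivative_inner_right[OF dg[OF s]]])
      have "normal (\<Psi> (\<gamma> s)) \<bullet> \<tau> s = 0" using tan[OF s] by (simp add: normal_def)
      then show "(\<lambda>x. normal p \<bullet> (x *\<^sub>R \<tau> s)) = (\<lambda>h. 0)"
        using n[OF s] by simp
    qed
    then have "normal p \<bullet> \<Psi> (\<gamma> 1) = normal p \<bullet> \<Psi> (\<gamma> 0)"
      by (intro has_derivative_zero_unique[of "{0..1}"]) auto
    then have "G p \<bullet> (\<Psi> y - p) = 0"
      using nz[OF pU] unfolding p0 by (simp add: normal_def \<gamma>_def w_def inner_diff_right)
    moreover have yV: "y \<in> V" using y(1) r(2) by blast
    moreover have "F (\<Psi> y) = 0" using FPsi[OF yV] y(2) by simp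
    ultimately have "\<Phi> (\<Psi> y) = \<Psi> y" by (simp add: \<Phi>_def)
    then show "\<Psi> y = y" using PsiU[OF yV] by simp
    moreover have "\<Psi> y \<in> S" using gS[of 1] by (simp add: \<gamma>_def w_def)
    ultimately show "y \<in> S" by simp
  qed
  \<comment> \<open>Both inclusions rest on \<open>Psi_id\<close>: for a point \<open>x\<close> of
    \<open>S\<close> it is applied to \<open>\<Phi> x\<close>, for a point of the hyperplane to
    \<open>x\<close> itself. Hence both have to lie in the ball.\<close>
  define W where "W = (U' \<inter> \<Phi> -` ball p r) \<inter> ball p r"
  have "open W"
    unfolding W_def using I(6)
    by (intro open_Int continuous_open_preimage[OF _ I(1)]) (auto simp: homeomorphism_def)
  moreover have "p \<in> W" using I(3) Pp r(1) by (simp add: W_def)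
  moreover have "S \<inter> W = {x \<in> W. G p \<bullet> (x - p) = 0}"
  proof safe
    fix x assume x: "x \<in> S" "x \<in> W"
    then have "G p \<bullet> (\<Phi> x - p) = 0" using S I(2) by (auto simp: GPhi W_def)
    moreover from this have "\<Psi> (\<Phi> x) = \<Phi> x" using x by (intro Psi_id) (auto simp: W_def)
    moreover have "\<Psi> (\<Phi> x) = x" using x homeomorphism_apply1[OF I(6)] by (simp add: W_def)
    ultimately show "G p \<bullet> (x - p) = 0" by simp
  qed (use Psi_id(2) in \<open>auto simp: W_def\<close>)
  ultimately show thesis by (rule that)
qed

end

section \<open>Global hyperplanes: connectedness, and minimality of flat pieces\<close>

text \<open>By the local description the affine tangent plane does not change along \<open>S\<close>
  near any point; connectedness makes it one plane for all of \<open>S\<close>.\<close>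

lemma openin_hyperplane_of_local:
  fixes S :: "'a::euclidean_space set"
  assumes conn: "connected S"
    and loc: "\<And>p. p \<in> S \<Longrightarrow> \<exists>n W. n \<noteq> 0 \<and> open W \<and> p \<in> W \<and> S \<inter> W = {x \<in> W. n \<bullet> (x - p) = 0}"
  shows "\<exists>a b. a \<noteq> 0 \<and> openin (top_of_set {x. a \<bullet> x = b}) S"
proof (cases "S = {}")
  case True
  obtain a :: 'a where "a \<in> Basis" using nonempty_Basis by blast
  then show ?thesis using True nonzero_Basis by auto
next
  case False
  then obtain p0 where p0: "p0 \<in> S" by blast
  \<comment> \<open>Built from \<open>tangent_space\<close>, this plane depends on \<open>S\<close>
    and \<open>q\<close> only, so the planes found with different \<open>n\<close> and
    \<open>W\<close> can be compared.\<close>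
  define P where "P q = {x. x - q \<in> tangent_space S q}" for q
  have P: "P q = {x. n \<bullet> (x - p) = 0}"
    if "n \<noteq> 0" "open W" "S \<inter> W = {x \<in> W. n \<bullet> (x - p) = 0}" "q \<in> S \<inter> W" for n W p q
  proof -
    have "tangent_space S q = {v. n \<bullet> v = 0}"
      using that
      by (intro tangent_space_level_set[where U = W and F = "\<lambda>x. n \<bullet> (x - p)" and G = "\<lambda>x. n"])
        (auto intro!: derivative_eq_intros)
    moreover have "n \<bullet> (q - p) = 0" using that by blast
    ultimately show ?thesis by (auto simp: P_def inner_diff_right)
  qed
  have const: "P q = P p0" if "q \<in> S" for q
  proof (rule connected_local_const[OF conn that p0], intro ballI)
    fix p assume p: "p \<in> S"
    obtain n W where nW: "n \<noteq> 0" "open W" "p \<in> W" "S \<inter> W = {x \<in> W. n \<bullet> (x - p) = 0}"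
      using loc[OF p] by blast
    have "P p = P q" if "q \<in> S \<inter> W" for q
      using P[OF nW(1,2,4) that] P[OF nW(1,2,4), of p] p nW(3) by simp
    then show "\<forall>\<^sub>F q in at p within S. P p = P q"
      using nW(2,3) by (auto simp: eventually_at_topological)
  qed
  obtain n W0 where n: "n \<noteq> 0" "open W0" "p0 \<in> W0" "S \<inter> W0 = {x \<in> W0. n \<bullet> (x - p0) = 0}"
    using loc[OF p0] by blast
  have P0: "P p0 = {x. n \<bullet> x = n \<bullet> p0}"
    using P[OF n(1,2,4), of p0] p0 n(3) by (auto simp: inner_diff_right)
  have "openin (top_of_set (P p0)) S"
  proof (subst openin_subopen, intro ballI)
    fix p assume p: "p \<in> S"
    obtain n W where nW: "n \<noteq> 0" "open W" "p \<in> W" "S \<inter> W = {x \<in> W. n \<bullet> (x - p) = 0}"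
      using loc[OF p] by blast
    have "P p0 = {x. n \<bullet> (x - p) = 0}"
      using P[OF nW(1,2,4), of p] p nW(3) const[OF p] by simp
    then have "P p0 \<inter> W = S \<inter> W" using nW(4) by blast
    moreover have "openin (top_of_set (P p0)) (P p0 \<inter> W)"
      using nW(2) by (rule openin_open_Int)
    ultimately show "\<exists>T. openin (top_of_set (P p0)) T \<and> p \<in> T \<and> T \<subseteq> S"
      using p nW(3) by (intro exI[of _ "P p0 \<inter> W"]) auto
  qed
  then show ?thesis using n(1) P0 by auto
qed

text \<open>The defining function is affine, so its Hessian is zero and both sides of the minimality
  criterion vanish.\<close>

lemma minimal_hypersurface_open_in_hyperplane:
  fixes a :: "'a::euclidean_space"
  assumes a: "a \<noteq> 0" and W: "open W"
  shows "minimal_hypersurface ({x. a \<bullet> x = b} \<inter> W)"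
proof -
  have der: "((\<lambda>x. a \<bullet> x - b) has_derivative (\<lambda>h. a \<bullet> h)) (at x)" for x
    by (auto intro!: derivative_eq_intros)
  have fd: "frechet_derivative (\<lambda>x. a \<bullet> x - b) (at x) = (\<lambda>h. a \<bullet> h)" for x
    using frechet_derivative_at[OF der] by simp
  have "C2_on (\<lambda>x. a \<bullet> x - b) W"
    unfolding C2_on_def
    by (rule exI[of _ "\<lambda>x. blinfun_inner_right a"], rule exI[of _ "\<lambda>x. 0"])
      (auto intro!: continuous_intros derivative_eq_intros simp: zero_blinfun.rep_eq)
  moreover have "(\<lambda>h. a \<bullet> h) \<noteq> (\<lambda>h. 0)" using a by (metis inner_eq_zero_iff)
  ultimately have C2: "C2_hypersurface ({x. a \<bullet> x = b} \<inter> W)"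
    unfolding C2_hypersurface_def using W fd by (intro ballI exI[of _ W] exI[of _ "\<lambda>x. a \<bullet> x - b"]) auto
  interpret level_set_chart "{x. a \<bullet> x = b} \<inter> W" W "\<lambda>x. a \<bullet> x - b" "\<lambda>x. a" "\<lambda>x. 0"
    by standard (use a W der in \<open>auto intro!: continuous_intros derivative_eq_intros simp: zero_blinfun.rep_eq\<close>)
  show ?thesis
    using C2 mean_curvature_vector_eq_0_iff[OF C2] by (auto simp: minimal_hypersurface_def)
qed

section \<open>The equivalence of the three conditions\<close>

theorem theorem3p1:
  fixes S :: "(real^'n) set" and g :: "'n \<Rightarrow> real"
  assumes "CARD('n) \<ge> 3"
    and "C2_hypersurface S" and "connected S"
    and "\<And>i. g i > 0" and "pair_sum_nonresonant g"
  shows "((\<forall>t>0. minimal_hypersurface (dilation g t ` S)) \<longleftrightarrow>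
          (\<exists>T. finite T \<and> T \<subseteq> {0<..} \<and> card T = CARD('n) choose 2 \<and>
             (\<forall>t\<in>T. minimal_hypersurface (dilation g t ` S)))) \<and>
         ((\<exists>T. finite T \<and> T \<subseteq> {0<..} \<and> card T = CARD('n) choose 2 \<and>
             (\<forall>t\<in>T. minimal_hypersurface (dilation g t ` S))) \<longleftrightarrow>
          (\<exists>a b. a \<noteq> 0 \<and> connected S \<and> openin (top_of_set {x. a \<bullet> x = b}) S))"
proof -
  have all_imp_ex: "\<exists>T. finite T \<and> T \<subseteq> {0<..} \<and> card T = CARD('n) choose 2 \<and>
      (\<forall>t\<in>T. minimal_hypersurface (dilation g t ` S))"
    if "\<forall>t>0. minimal_hypersurface (dilation g t ` S)"
    using that
    \<comment> \<open>The integers from 1 up to the number of pairs serve as the distinct positive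
      parameters.\<close>
    by (intro exI[of _ "real ` {1..CARD('n) choose 2}"]) (auto simp: card_image)
  have hyperplane_imp_all: "\<forall>t>0. minimal_hypersurface (dilation g t ` S)"
    if ab: "a \<noteq> 0" "openin (top_of_set {x. a \<bullet> x = b}) S" for a b
  proof (intro allI impI)
    fix t :: real assume t: "t > 0"
    define E where "E = dilation (\<lambda>i. - g i) t"
    obtain W where W: "open W" "S = {x. a \<bullet> x = b} \<inter> W"
      using ab(2) by (auto simp: openin_open)
    have "open (E -` W)"
      unfolding E_def
      by (rule open_vimage[OF W(1) linear_continuous_on[OF bounded_linear_dilation]])
    moreover have "E a \<noteq> 0"
      using ab(1) dilation_inverse(2)[OF t, of g a]
      by (auto simp: E_def dilation_def vec_eq_iff)
    \<comment> \<open>Self-adjointness moves \<open>E\<close> onto the normal: the image of the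
      hyperplane has normal \<open>E a\<close> and the same \<open>b\<close>.\<close>
    moreover have "dilation g t ` S = {y. E a \<bullet> y = b} \<inter> E -` W"
      unfolding dilation_image_eq[OF t] W(2) by (auto simp: E_def dilation_self_adjoint)
    ultimately show "minimal_hypersurface (dilation g t ` S)"
      using minimal_hypersurface_open_in_hyperplane by metis
  qed
  have ex_imp_hyperplane: "\<exists>a b. a \<noteq> 0 \<and> openin (top_of_set {x. a \<bullet> x = b}) S"
    if T: "finite T" "T \<subseteq> {0<..}" "card T = CARD('n) choose 2"
      "\<forall>t\<in>T. minimal_hypersurface (dilation g t ` S)" for T
  proof (rule openin_hyperplane_of_local[OF assms(3)])
    fix p assume p: "p \<in> S"
    obtain U F G and H :: "real^'n \<Rightarrow> (real^'n) \<Rightarrow>\<^sub>L (real^'n)" where U: "open U" and pU: "p \<in> U"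
      and F: "\<And>x. x \<in> U \<Longrightarrow> (F has_derivative (\<lambda>h. G x \<bullet> h)) (at x)"
      and G: "\<And>x. x \<in> U \<Longrightarrow> (G has_derivative blinfun_apply (H x)) (at x)"
      and H: "continuous_on U H" and G0: "\<And>x. x \<in> U \<Longrightarrow> G x \<noteq> 0"
      and SU: "S \<inter> U = {x \<in> U. F x = 0}"
      by (rule C2_hypersurfaceE[OF assms(2) p]) (rule that)
    have chart: "level_set_chart S U F G H"
      by standard (fact U F G H G0 SU)+
    interpret level_set_chart S U F G H by fact
    have flat: "H x u \<bullet> v = 0" if "x \<in> S \<inter> U" "G x \<bullet> u = 0" "G x \<bullet> v = 0" for x u v
    proof (rule second_fundamental_form_zero[OF chart _ that])
      fix x i j assume "x \<in> S \<inter> U" "(i::'n) \<noteq> j"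
      then show "(G x $ i)\<^sup>2 * H x (axis j 1) $ j + (G x $ j)\<^sup>2 * H x (axis i 1) $ i =
          G x $ i * G x $ j * (H x (axis i 1) $ j + H x (axis j 1) $ i)"
        using T by (intro pairwise_quadratic_relation[OF chart _ _ assms(5), of x T]) auto
    qed
    obtain W where "open W" "p \<in> W" "S \<inter> W = {x \<in> W. G p \<bullet> (x - p) = 0}"
      by (rule locally_hyperplane[OF _ flat]) (use p pU in auto)
    then show "\<exists>n W. n \<noteq> 0 \<and> open W \<and> p \<in> W \<and> S \<inter> W = {x \<in> W. n \<bullet> (x - p) = 0}"
      using nz[OF pU] by (intro exI[of _ "G p"] exI[of _ W] conjI)
  qed
  \<comment> \<open>Both equivalences follow from one cycle: finitely many parameters give the
    hyperplane, the hyperplane gives all parameters, and these give finitely many.\<close>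
  show ?thesis
  proof (intro conjI iffI)
    assume "\<exists>T. finite T \<and> T \<subseteq> {0<..} \<and> card T = CARD('n) choose 2 \<and>
      (\<forall>t\<in>T. minimal_hypersurface (dilation g t ` S))"
    then obtain a b where ab: "a \<noteq> 0" "openin (top_of_set {x. a \<bullet> x = b}) S"
      using ex_imp_hyperplane by (elim exE conjE) metis
    show "\<forall>t>0. minimal_hypersurface (dilation g t ` S)"
      by (rule hyperplane_imp_all[OF ab])
    show "\<exists>a b. a \<noteq> 0 \<and> connected S \<and> openin (top_of_set {x. a \<bullet> x = b}) S"
      using ab assms(3) by metis
  next
    assume "\<exists>a b. a \<noteq> 0 \<and> connected S \<and> openin (top_of_set {x. a \<bullet> x = b}) S"
    then show "\<exists>T. finite T \<and> T \<subseteq> {0<..} \<and> card T = CARD('n) choose 2 \<and>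
      (\<forall>t\<in>T. minimal_hypersurface (dilation g t ` S))"
      by (elim exE conjE) (rule all_imp_ex[OF hyperplane_imp_all])
  qed (rule all_imp_ex)
qed

end
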